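(* Let $n$ be a positive integer. Then $$t(1,1,2,8;n)=\begin{cases}4\sigma(2n+3)&\text{if } 2\mid n,\\ 4\sigma(2n+3)+4(-1)^{\frac{n-1}2}\sum\limits_{\substack{(r,s)\in\mathbb Z^2,\ 4\mid r-1\\ 2n+3=r^2+4s^2}} r&\text{if } 2\nmid n.\end{cases}$$
   Context: $\sigma(n)=\sum_{d\mid n,\,d\ge1}d$. For positive integers $a,b,c,d$ and a nonnegative integer $n$, $t(a,b,c,d;n)$ denotes the number of $(x,y,z,w)\in\mathbb Z^4$ with $n=a\frac{x(x-1)}2+b\frac{y(y-1)}2+c\frac{z(z-1)}2+d\frac{w(w-1)}2$. *)

theory Defs
  imports Main
begin

definition sigma :: "nat \<Rightarrow> nat" where
  "sigma n = (\<Sum>d | d dvd n. d)"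

(* x * (x - 1) is even, so the integer division by 2 is exact. *)
definition t :: "nat \<Rightarrow> nat \<Rightarrow> nat \<Rightarrow> nat \<Rightarrow> nat \<Rightarrow> nat" where
  "t a b c d n = card {(x::int, y::int, z::int, w::int).
     int n = int a * (x * (x - 1) div 2) + int b * (y * (y - 1) div 2)
           + int c * (z * (z - 1) div 2) + int d * (w * (w - 1) div 2)}"

end

theory Submission
  imports Defs
begin

text \<open>
  Put $N = 2n + 3$. Completing squares and passing to half sums and differences gives
  $t(1,1,2,8;n) = |Q| - \sum_Q (-1)^{s/2}$, where $Q$ is the set of solutions of
  $2N = p^2 + q^2 + r^2 + s^2$ with $p, r$ odd and $q, s$ even.

  The two-square theorem writes $|Q|$ as $4 \sum \chi(a) \chi(b)$ over $2N = ax + by$ with odd positive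
  $a, x, b, y$, $\chi$ being the nontrivial character modulo 4; an involution of Dirichlet cancels the
  terms with $a \neq b$ and the rest is $4\sigma(N)$.

  The signed sum vanishes for $N \equiv 3$ modulo 4 by exchanging $q$ and $s$. For $N \equiv 1$ it is
  reduced to $N = a^2 + 4(b^2 + e^2 + f^2)$ with sign $(-1)^b$, and for fixed $f$ the sum over
  $a, b, e$ is evaluated by Jacobi's identity for the cube of the eta function.

  The two-square theorem and the Jacobi identity both follow from one identity of Liouville type for
  sums over $n = i^2 + de$.
\<close>

subsection \<open>A Liouville-type identity\<close>

definition chi :: "int \<Rightarrow> int" where
  "chi x = (if x mod 4 = 1 then 1 else if x mod 4 = 3 then -1 else 0)"

text \<open>The sign \<open>(-1)^x\<close>, given by parity so that negative exponents are
  allowed.\<close>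

definition sg :: "int \<Rightarrow> int" where
  "sg x = (if even x then 1 else -1)"

definition divisor_sols :: "int \<Rightarrow> (int \<times> int \<times> int) set" where
  "divisor_sols n = {(i, d, e). d > 0 \<and> e > 0 \<and> n = i\<^sup>2 + d * e}"

lemma square_le_imp_abs_le:
  fixes x n :: int
  assumes "x\<^sup>2 \<le> n"
  shows "- n \<le> x \<and> x \<le> n"
proof -
  have "\<bar>x\<bar> \<le> x\<^sup>2"
  proof (cases "x = 0")
    case False
    hence "\<bar>x\<bar> * 1 \<le> \<bar>x\<bar> * \<bar>x\<bar>" by (intro mult_left_mono) auto
    thus ?thesis by (simp add: power2_eq_square)
  qed simp
  with assms show ?thesis by linarith
qed

lemma mult_le_imp_factors_le:
  fixes d e n :: int
  assumes "d > 0" "e > 0" "d * e \<le> n"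
  shows "d \<le> n \<and> e \<le> n"
proof -
  have "d * 1 \<le> d * e" "1 * e \<le> d * e"
    using assms by (intro mult_mono; simp)+
  with assms show ?thesis by linarith
qed

lemma finite_divisor_sols: "finite (divisor_sols n)"
proof (rule finite_subset)
  show "divisor_sols n \<subseteq> {-n..n} \<times> {1..n} \<times> {1..n}"
  proof
    fix p assume "p \<in> divisor_sols n"
    then obtain i d e where p: "p = (i, d, e)" "d > 0" "e > 0" "n = i\<^sup>2 + d * e"
      by (auto simp: divisor_sols_def)
    have "d * e \<ge> 0" "i\<^sup>2 \<ge> 0" using p by auto
    hence "i\<^sup>2 \<le> n" "d * e \<le> n" using p by linarith+
    with square_le_imp_abs_le[of i n] mult_le_imp_factors_le[of d e n] p
    show "p \<in> {-n..n} \<times> {1..n} \<times> {1..n}" by auto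
  qed
qed simp

text \<open>Reindexing by the involution \<open>h\<close> turns the sum into its own negative. At a
  fixed point the last assumption forces \<open>f x = 0\<close>, so such points contribute nothing.
  The cancellation arguments below are instances of this.\<close>

lemma sum_antisymmetric_eq_0:
  fixes f :: "'a \<Rightarrow> int"
  assumes "\<And>x. x \<in> S \<Longrightarrow> h x \<in> S" "\<And>x. x \<in> S \<Longrightarrow> h (h x) = x"
    and "\<And>x. x \<in> S \<Longrightarrow> f (h x) = - f x"
  shows "sum f S = 0"
proof -
  have "sum f S = (\<Sum>x\<in>S. - f x)"
    by (rule sum.reindex_bij_witness[of _ h h]) (use assms in auto)
  thus ?thesis by (simp add: sum_negf)
qed

text \<open>Think of $(i, d, e)$ as the indefinite form $dX^2 + 2iXY - eY^2$ of discriminant $4n$. The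
  substitution $X \mapsto X + Y$ carries the terms with $e > d + 2i$ of the second sum to the terms
  with $e > d - 2i$ of the first, half of it (up to the boundary) by the symmetry
  $(i, d, e) \mapsto (-i, e, d)$.
  Where $e < d + 2i$, the substitution $Y \mapsto X + Y$ followed by $i \mapsto -i$ is an involution
  that negates $e - 2i$ and fixes $d + i$.\<close>

theorem liouville_identity:
  fixes f g :: "int \<Rightarrow> int"
  assumes f: "\<And>x. f (- x) = - f x" and g: "\<And>y. g (- y) = g y"
  shows "(\<Sum>(i, d, e)\<in>divisor_sols n. f (d + e) * g i) =
    2 * (\<Sum>(i, d, e)\<in>divisor_sols n. f (e - 2 * i) * g (d + i))
    - 2 * (\<Sum>(i, d, e)\<in>{(i, d, e) \<in> divisor_sols n. e = d + 2 * i}. f d * g (d + i))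
    + (\<Sum>(i, d, e)\<in>{(i, d, e) \<in> divisor_sols n. e = d - 2 * i}. f (d + e) * g i)"
proof -
  let ?S = "divisor_sols n"
  let ?F = "\<lambda>(i, d, e). f (d + e) * g i" and ?G = "\<lambda>(i, d, e). f (e - 2 * i) * g (d + i)"
  define A B Z where "A = {(i, d, e) \<in> ?S. e > d + 2 * i}"
    and "B = {(i, d, e) \<in> ?S. e < d + 2 * i}" and "Z = {(i, d, e) \<in> ?S. e = d + 2 * i}"
  define A' B' Z' where "A' = {(i, d, e) \<in> ?S. e > d - 2 * i}"
    and "B' = {(i, d, e) \<in> ?S. e < d - 2 * i}" and "Z' = {(i, d, e) \<in> ?S. e = d - 2 * i}"
  have f': "f (x - y) = - f (y - x)" for x y
    using f[of "y - x"] by simp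
  have split3: "sum h ?S = sum h X + sum h Y + sum h W"
    if "?S = X \<union> Y \<union> W" "X \<inter> Y = {}" "(X \<union> Y) \<inter> W = {}" for h :: "_ \<Rightarrow> int" and X Y W
  proof -
    have "finite (X \<union> Y \<union> W)" using finite_divisor_sols[of n] that(1) by simp
    thus ?thesis using that by (simp add: sum.union_disjoint)
  qed
  have G: "sum ?G ?S = sum ?G A + sum ?G B + sum ?G Z"
    by (rule split3) (auto simp: A_def B_def Z_def)
  have F: "sum ?F ?S = sum ?F A' + sum ?F B' + sum ?F Z'"
    by (rule split3) (auto simp: A'_def B'_def Z'_def)
  have GB: "sum ?G B = 0"
    by (rule sum_antisymmetric_eq_0[where h = "\<lambda>(i, d, e). (e - i, d + 2 * i - e, e)"])
      (auto simp: B_def divisor_sols_def power2_eq_square algebra_simps f'[of "_ * 2"])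
  \<comment> \<open>The inequality defining \<open>A\<close> is positivity of the new third entry
    \<open>e - 2 * i - d\<close>, and the inequality defining \<open>A'\<close> expresses positivity
    of the old one.\<close>
  have GA: "sum ?G A = sum ?F A'"
    by (rule sum.reindex_bij_witness[where j = "\<lambda>(i, d, e). (i + d, d, e - 2 * i - d)"
          and i = "\<lambda>(i, d, e). (i - d, d, e + 2 * i - d)"])
      (auto simp: A_def A'_def divisor_sols_def power2_eq_square algebra_simps)
  have FB: "sum ?F B' = sum ?F A'"
    by (rule sum.reindex_bij_witness[where j = "\<lambda>(i, d, e). (- i, e, d)"
          and i = "\<lambda>(i, d, e). (- i, e, d)"])
      (auto simp: A'_def B'_def divisor_sols_def g algebra_simps)
  have "sum ?G Z = (\<Sum>(i, d, e)\<in>Z. f d * g (d + i))"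
    by (rule sum.cong) (auto simp: Z_def)
  with G F GB GA FB show ?thesis
    unfolding Z_def Z'_def by simp
qed

subsection \<open>Sums of two squares\<close>

text \<open>The divisor sum of the character \<open>chi\<close>. It is defined on all integers, with
  value 0 for \<open>k \<le> 0\<close>, so that it can be evaluated at \<open>n - i^2\<close> for
  every \<open>i\<close>.\<close>

definition chi_sum :: "int \<Rightarrow> int" where
  "chi_sum k = (\<Sum>(d, e)\<in>{(d, e). d > 0 \<and> e > 0 \<and> d * e = k}. chi d)"

definition two_squares :: "int \<Rightarrow> (int \<times> int) set" where
  "two_squares k = {(x, y). x\<^sup>2 + y\<^sup>2 = k}"

lemma chi_minus: "chi (- x) = - chi x"
  unfolding chi_def by presburger

lemma chi_even [simp]: "even x \<Longrightarrow> chi x = 0"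
  unfolding chi_def by presburger

text \<open>A shift by 2 exchanges the odd residues 1 and 3 modulo 4.\<close>

lemma chi_add_2_mult: "chi (x + 2 * y) = chi x * sg y"
  unfolding chi_def sg_def by (cases "even y"; simp; presburger)

lemma chi_diff_2_mult: "chi (x - 2 * y) = chi x * sg y"
  using chi_add_2_mult[of x "- y"] by (simp add: sg_def)

lemma sg_mult_odd: "odd x \<Longrightarrow> sg (x * y) = sg y"
  by (simp add: sg_def)

text \<open>Only odd \<open>d\<close> contribute, and then \<open>d * e\<close> and \<open>e\<close>
  have the same parity.\<close>

lemma chi_mult_sg: "chi d * sg (d * e) = chi d * sg e"
  by (cases "even d") (auto simp: sg_mult_odd)

lemma sum_chi_interval:
  "(\<Sum>k\<in>{1..int m}. chi k) = (if m mod 4 = 1 \<or> m mod 4 = 2 then 1 else 0)"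
proof (induction m)
  case (Suc m)
  have "{1..int (Suc m)} = insert (int (Suc m)) {1..int m}" by auto
  hence *: "(\<Sum>k\<in>{1..int (Suc m)}. chi k) = chi (int (Suc m)) + (\<Sum>k\<in>{1..int m}. chi k)"
    by simp
  have "int (Suc m) mod 4 = int (Suc m mod 4)" by (simp add: zmod_int)
  moreover have "m mod 4 = 0 \<or> m mod 4 = 1 \<or> m mod 4 = 2 \<or> m mod 4 = 3" by presburger
  ultimately show ?case unfolding * Suc.IH by (auto simp: mod_Suc chi_def)
qed simp

lemma finite_factorizations: "finite {(d::int, e). d > 0 \<and> e > 0 \<and> d * e = k}"
proof (rule finite_subset)
  show "{(d::int, e). d > 0 \<and> e > 0 \<and> d * e = k} \<subseteq> {1..k} \<times> {1..k}"
  proof clarify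
    fix d e :: int assume "d > 0" "e > 0"
    with mult_le_imp_factors_le[of d e "d * e"]
    show "d \<in> {1..d * e} \<and> e \<in> {1..d * e}" by auto
  qed
qed simp

lemma finite_two_squares: "finite (two_squares k)"
proof (rule finite_subset)
  show "two_squares k \<subseteq> {-k..k} \<times> {-k..k}"
  proof
    fix p assume "p \<in> two_squares k"
    then obtain x y where p: "p = (x, y)" "x\<^sup>2 + y\<^sup>2 = k" by (auto simp: two_squares_def)
    hence "x\<^sup>2 \<le> k" "y\<^sup>2 \<le> k"
      using zero_le_power2[of x] zero_le_power2[of y] by linarith+
    thus "p \<in> {-k..k} \<times> {-k..k}" using square_le_imp_abs_le[of x k] square_le_imp_abs_le[of y k] p
      by auto
  qed
qed simp

lemma chi_sum_nonpos: "k \<le> 0 \<Longrightarrow> chi_sum k = 0"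
proof -
  assume "k \<le> 0"
  hence "{(d::int, e). d > 0 \<and> e > 0 \<and> d * e = k} = {}"
    by (auto dest: mult_pos_pos)
  thus ?thesis by (simp only: chi_sum_def) simp
qed

lemma two_squares_neg: "k < 0 \<Longrightarrow> two_squares k = {}"
  by (auto simp: two_squares_def not_less dest: sum_power2_ge_zero[THEN order.strict_trans1])

lemma two_squares_0: "two_squares 0 = {(0, 0)}"
  by (auto simp: two_squares_def sum_power2_eq_zero_iff)

text \<open>The terms with $u \not\equiv v$ modulo 2 cancel in pairs; the others are
  $u = x + y$, $v = x - y$.\<close>

lemma sum_sg_two_squares:
  "(\<Sum>(u, v)\<in>two_squares k. sg u) = (if even k then sg (k div 2) * int (card (two_squares (k div 2))) else 0)"
proof (cases "even k")
  case False
  have "(\<Sum>(u, v)\<in>two_squares k. sg u) = 0"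
  proof (rule sum_antisymmetric_eq_0[where h = "\<lambda>(u, v). (v, u)"]; clarsimp)
    fix u v assume "(u, v) \<in> two_squares k"
    hence "odd (u\<^sup>2 + v\<^sup>2)" using False by (auto simp: two_squares_def)
    thus "sg v = - sg u" by (auto simp: sg_def)
  qed (auto simp: two_squares_def)
  thus ?thesis using False by simp
next
  case True
  then obtain m where m: "k = 2 * m" by blast
  have "(\<Sum>(u, v)\<in>two_squares k. sg u) = (\<Sum>(x, y)\<in>two_squares m. sg m)"
  proof (rule sum.reindex_bij_witness[where i = "\<lambda>(x, y). (x + y, x - y)"
        and j = "\<lambda>(u, v). ((u + v) div 2, (u - v) div 2)"]; clarsimp)
    fix u v assume uv: "(u, v) \<in> two_squares k"
    hence "even (u\<^sup>2 + v\<^sup>2)" using m by (auto simp: two_squares_def)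
    hence "even (u + v)" by auto
    then obtain x where x: "u + v = 2 * x" by blast
    define y where "y = u - x"
    have uv': "u = x + y" "v = x - y" using x by (auto simp: y_def)
    show "(u + v) div 2 + (u - v) div 2 = u \<and> (u + v) div 2 - (u - v) div 2 = v"
      by (simp add: uv')
    show "((u + v) div 2, (u - v) div 2) \<in> two_squares m"
      using uv m by (simp add: uv' two_squares_def power2_eq_square algebra_simps)
    have "m = x\<^sup>2 + y\<^sup>2"
      using uv m by (simp add: uv' two_squares_def power2_eq_square algebra_simps)
    thus "sg m = sg u" by (simp add: uv' sg_def)
  qed (auto simp: two_squares_def m power2_eq_square algebra_simps)
  thus ?thesis by (simp add: m split_def)
qed

text \<open>On generating functions, \<open>half_twist\<close> is the substitution $q \mapsto -q^2$. Both sides of the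
  two-square theorem satisfy $\varphi(-q) F(q) = \varphi(q) F(-q^2)$, which determines $F$ from its
  constant term.\<close>

definition half_twist :: "(int \<Rightarrow> int) \<Rightarrow> int \<Rightarrow> int" where
  "half_twist F k = (if even k then sg (k div 2) * F (k div 2) else 0)"

text \<open>Both sides are signed counts of the triples with \<open>n = i^2 + x^2 + y^2\<close>. By
  symmetry the sign may be carried by \<open>x\<close> instead of \<open>i\<close>, and the sum over
  \<open>(x, y)\<close> for fixed \<open>i\<close> is then a value of
  \<open>half_twist\<close>.\<close>

lemma two_squares_recurrence:
  "(\<Sum>i\<in>{-n..n}. sg i * int (card (two_squares (n - i\<^sup>2)))) =
   (\<Sum>i\<in>{-n..n}. half_twist (\<lambda>k. int (card (two_squares k))) (n - i\<^sup>2))"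
proof -
  let ?T = "SIGMA i:{-n..n}. two_squares (n - i\<^sup>2)"
  have bd: "-n \<le> i \<and> i \<le> n" if "n = i\<^sup>2 + (x\<^sup>2 + y\<^sup>2)" for i x y
  proof (rule square_le_imp_abs_le)
    show "i\<^sup>2 \<le> n" unfolding that by simp
  qed
  have T: "?T = {(i, x, y). n = i\<^sup>2 + (x\<^sup>2 + y\<^sup>2)}"
    using bd by (auto simp: two_squares_def)
  have "(\<Sum>i\<in>{-n..n}. sg i * int (card (two_squares (n - i\<^sup>2)))) =
    (\<Sum>i\<in>{-n..n}. \<Sum>p\<in>two_squares (n - i\<^sup>2). sg i)"
    by (simp add: mult.commute)
  also have "\<dots> = (\<Sum>(i, p)\<in>?T. sg i)"
    by (rule sum.Sigma) (auto simp: finite_two_squares)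
  also have "\<dots> = (\<Sum>(i, p)\<in>?T. sg (fst p))"
    unfolding T
    by (rule sum.reindex_bij_witness[where i = "\<lambda>(i, x, y). (x, i, y)"
        and j = "\<lambda>(i, x, y). (x, i, y)"]) auto
  also have "\<dots> = (\<Sum>i\<in>{-n..n}. \<Sum>(x, y)\<in>two_squares (n - i\<^sup>2). sg x)"
    by (subst sum.Sigma) (auto simp: finite_two_squares split_def)
  also have "\<dots> = (\<Sum>i\<in>{-n..n}. half_twist (\<lambda>k. int (card (two_squares k))) (n - i\<^sup>2))"
    by (simp only: sum_sg_two_squares half_twist_def)
  finally show ?thesis .
qed

lemma sum_divisor_sols:
  "(\<Sum>i\<in>{-n..n}. \<Sum>(d, e)\<in>{(d, e). d > 0 \<and> e > 0 \<and> d * e = n - i\<^sup>2}. h i d e) =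
   (\<Sum>(i, d, e)\<in>divisor_sols n. h i d e)"
  for h :: "int \<Rightarrow> int \<Rightarrow> int \<Rightarrow> int"
proof -
  have "(SIGMA i:{-n..n}. {(d, e). d > 0 \<and> e > 0 \<and> d * e = n - i\<^sup>2}) = divisor_sols n"
  proof -
    have "-n \<le> i \<and> i \<le> n" if "d > 0" "e > 0" "n = i\<^sup>2 + d * e" for i d e
    proof (rule square_le_imp_abs_le)
      show "i\<^sup>2 \<le> n" using mult_pos_pos[OF that(1,2)] that(3) by linarith
    qed
    thus ?thesis by (fastforce simp: divisor_sols_def)
  qed
  thus ?thesis by (subst sum.Sigma) (auto simp: finite_factorizations)
qed

section \<open>Boundary terms of the Liouville identity\<close>

text \<open>On the two boundaries \<open>n\<close> completes to \<open>(i + d)^2\<close> and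
  \<open>(i - d)^2\<close> respectively.\<close>

lemma boundary_sols_nonsquare:
  assumes "\<And>s. n \<noteq> s\<^sup>2"
  shows "{(i, d, e) \<in> divisor_sols n. e = d + 2 * i} = {}"
    and "{(i, d, e) \<in> divisor_sols n. e = d - 2 * i} = {}"
proof -
  have "n = (i + d)\<^sup>2" if "n = i\<^sup>2 + d * (d + 2 * i)" for i d
    using that by (simp add: power2_eq_square algebra_simps)
  thus "{(i, d, e) \<in> divisor_sols n. e = d + 2 * i} = {}"
    using assms by (auto simp: divisor_sols_def)
  have "n = (i - d)\<^sup>2" if "n = i\<^sup>2 + d * (d - 2 * i)" for i d
    using that by (simp add: power2_eq_square algebra_simps)
  thus "{(i, d, e) \<in> divisor_sols n. e = d - 2 * i} = {}"
    using assms by (auto simp: divisor_sols_def)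
qed

text \<open>On the first boundary \<open>2 * (i + d) = d + e > 0\<close>, so
  \<open>(i + d)^2 = s^2\<close> forces \<open>i + d = s\<close>. Hence \<open>d\<close> determines
  the term, and \<open>e = 2 * s - d > 0\<close> bounds \<open>d\<close> by
  \<open>2 * s - 1\<close>. The second boundary is the image of the first under \<open>i\<close> ->
  \<open>- i\<close>.\<close>

lemma sum_boundary_sols_square:
  fixes s :: int and h :: "int \<Rightarrow> int \<Rightarrow> int \<Rightarrow> int"
  assumes "s > 0"
  shows "(\<Sum>(i, d, e)\<in>{(i, d, e) \<in> divisor_sols (s\<^sup>2). e = d + 2 * i}. h i d e) =
      (\<Sum>d\<in>{1..2 * s - 1}. h (s - d) d (2 * s - d))" (is ?plus)
    and "(\<Sum>(i, d, e)\<in>{(i, d, e) \<in> divisor_sols (s\<^sup>2). e = d - 2 * i}. h i d e) =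
      (\<Sum>d\<in>{1..2 * s - 1}. h (d - s) d (2 * s - d))" (is ?minus)
proof -
  have root: "s = i + d" if "d > 0" "d + 2 * i > 0" "s\<^sup>2 = i\<^sup>2 + d * (d + 2 * i)" for i d
  proof -
    have "s\<^sup>2 = (i + d)\<^sup>2" using that(3) by (simp add: power2_eq_square algebra_simps)
    thus ?thesis using that(1,2) assms by (subst (asm) power2_eq_iff_nonneg) auto
  qed
  show ?plus
  proof (rule sum.reindex_bij_witness[where j = "\<lambda>(i, d, e). d" and i = "\<lambda>d. (s - d, d, 2 * s - d)"])
    fix p assume p: "p \<in> {(i, d, e) \<in> divisor_sols (s\<^sup>2). e = d + 2 * i}"
    obtain i d e where ide: "p = (i, d, e)" by (cases p)
    have *: "e = d + 2 * i" "d > 0" "e > 0" "s\<^sup>2 = i\<^sup>2 + d * (d + 2 * i)"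
      using p by (auto simp: ide divisor_sols_def)
    have "s = i + d" using root[of d i] * by auto
    thus "(s - (case p of (i, d, e) \<Rightarrow> d), (case p of (i, d, e) \<Rightarrow> d), 2 * s - (case p of (i, d, e) \<Rightarrow> d)) = p"
      and "(case p of (i, d, e) \<Rightarrow> d) \<in> {1..2 * s - 1}"
      and "h (s - (case p of (i, d, e) \<Rightarrow> d)) (case p of (i, d, e) \<Rightarrow> d) (2 * s - (case p of (i, d, e) \<Rightarrow> d)) = (case p of (i, d, e) \<Rightarrow> h i d e)"
      using * by (auto simp: ide)
  qed (auto simp: divisor_sols_def power2_eq_square algebra_simps)
  show ?minus
  proof (rule sum.reindex_bij_witness[where j = "\<lambda>(i, d, e). d" and i = "\<lambda>d. (d - s, d, 2 * s - d)"])
    fix p assume p: "p \<in> {(i, d, e) \<in> divisor_sols (s\<^sup>2). e = d - 2 * i}"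
    obtain i d e where ide: "p = (i, d, e)" by (cases p)
    have *: "e = d - 2 * i" "d > 0" "e > 0" "s\<^sup>2 = (- i)\<^sup>2 + d * (d + 2 * (- i))"
      using p by (auto simp: ide divisor_sols_def)
    have "s = - i + d" using root[of d "- i"] * by auto
    thus "((case p of (i, d, e) \<Rightarrow> d) - s, (case p of (i, d, e) \<Rightarrow> d), 2 * s - (case p of (i, d, e) \<Rightarrow> d)) = p"
      and "(case p of (i, d, e) \<Rightarrow> d) \<in> {1..2 * s - 1}"
      and "h ((case p of (i, d, e) \<Rightarrow> d) - s) (case p of (i, d, e) \<Rightarrow> d) (2 * s - (case p of (i, d, e) \<Rightarrow> d)) = (case p of (i, d, e) \<Rightarrow> h i d e)"
      using * by (auto simp: ide)
  qed (auto simp: divisor_sols_def power2_eq_square algebra_simps)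
qed

lemma sum_chi_odd_interval: "s > 0 \<Longrightarrow> (\<Sum>k\<in>{1..2 * s - 1}. chi k) = (if odd s then 1 else 0)"
proof -
  assume s: "s > 0"
  define m where "m = nat (2 * s - 1)"
  have m: "int m = 2 * s - 1" using s by (simp add: m_def)
  have "(\<Sum>k\<in>{1..2 * s - 1}. chi k) = (if m mod 4 = 1 \<or> m mod 4 = 2 then 1 else 0)"
    unfolding m[symmetric] by (rule sum_chi_interval)
  also have "(m mod 4 = 1 \<or> m mod 4 = 2) \<longleftrightarrow> odd s"
    using m by presburger
  finally show ?thesis by simp
qed

section \<open>The recurrence for the divisor side and the two-square theorem\<close>

text \<open>Writing the even factor as \<open>2 * e\<close> gives
  \<open>chi (d + 2 * e) = chi d * sg e\<close>, and \<open>sg e\<close> may be replaced by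
  \<open>sg (d * e)\<close>, which is constant on the factorizations of
  \<open>k div 2\<close>.\<close>

lemma half_twist_chi_sum:
  "half_twist chi_sum k =
   (\<Sum>(d, e)\<in>{(d, e). d > 0 \<and> e > 0 \<and> d * e = k}. if even e then chi (d + e) else 0)"
proof (cases "even k")
  case False
  thus ?thesis by (auto simp: half_twist_def intro!: sum.neutral)
next
  case True
  then obtain m where m: "k = 2 * m" by blast
  have "(\<Sum>(d, e)\<in>{(d, e). d > 0 \<and> e > 0 \<and> d * e = k}. if even e then chi (d + e) else 0) =
    (\<Sum>(d, e)\<in>{(d, e). d > 0 \<and> e > 0 \<and> d * e = k \<and> even e}. chi (d + e))"
    by (rule sum.mono_neutral_cong_right) (auto simp: finite_factorizations split: if_splits)
  also have "\<dots> = (\<Sum>(d, e)\<in>{(d, e). d > 0 \<and> e > 0 \<and> d * e = m}. chi (d + 2 * e))"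
    by (rule sum.reindex_bij_witness[where i = "\<lambda>(d, e). (d, 2 * e)" and j = "\<lambda>(d, e). (d, e div 2)"])
      (auto simp: m)
  also have "\<dots> = (\<Sum>(d, e)\<in>{(d, e). d > 0 \<and> e > 0 \<and> d * e = m}. sg m * chi d)"
    by (rule sum.cong) (auto simp: chi_add_2_mult chi_mult_sg mult.commute[of "sg _"])
  also have "\<dots> = sg m * chi_sum m"
    by (simp add: chi_sum_def sum_distrib_left split_def)
  finally show ?thesis by (simp add: half_twist_def m)
qed

text \<open>\<open>chi (d + e)\<close> vanishes unless exactly one of \<open>d\<close> and
  \<open>e\<close> is even. The two cases are exchanged by symmetry, which accounts for the factor
  2. The right side is the left side of the Liouville identity for \<open>f = chi\<close> and
  \<open>g = 1\<close>.\<close>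

lemma sum_half_twist_chi_sum:
  "2 * (\<Sum>i\<in>{-n..n}. half_twist chi_sum (n - i\<^sup>2)) = (\<Sum>(i, d, e)\<in>divisor_sols n. chi (d + e))"
proof -
  let ?E = "\<Sum>(i, d, e)\<in>divisor_sols n. if even e then chi (d + e) else 0"
  have "(\<Sum>(i, d, e)\<in>divisor_sols n. chi (d + e)) =
    (\<Sum>p\<in>divisor_sols n. (case p of (i, d, e) \<Rightarrow> if even e then chi (d + e) else 0)
       + (case p of (i, d, e) \<Rightarrow> if even d then chi (d + e) else 0))"
    by (rule sum.cong) auto
  also have "\<dots> = ?E + (\<Sum>(i, d, e)\<in>divisor_sols n. if even d then chi (d + e) else 0)"
    by (simp add: sum.distrib)
  also have "(\<Sum>(i, d, e)\<in>divisor_sols n. if even d then chi (d + e) else 0) = ?E"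
    by (rule sum.reindex_bij_witness[where i = "\<lambda>(i, d, e). (i, e, d)" and j = "\<lambda>(i, d, e). (i, e, d)"])
      (auto simp: divisor_sols_def algebra_simps)
  also have "?E = (\<Sum>i\<in>{-n..n}. half_twist chi_sum (n - i\<^sup>2))"
    unfolding half_twist_chi_sum by (rule sum_divisor_sols[symmetric])
  finally show ?thesis by simp
qed

lemma sum_roots_of_square:
  fixes h :: "int \<Rightarrow> int"
  assumes "s > 0"
  shows "(\<Sum>i\<in>{-(s\<^sup>2)..s\<^sup>2}. if s\<^sup>2 - i\<^sup>2 = 0 then h i else 0) = h s + h (- s)"
proof -
  have "(\<Sum>i\<in>{-(s\<^sup>2)..s\<^sup>2}. if s\<^sup>2 - i\<^sup>2 = 0 then h i else 0) = (\<Sum>i\<in>{s, - s}. h i)"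
  proof (rule sum.mono_neutral_cong_right)
    show "{s, - s} \<subseteq> {-(s\<^sup>2)..s\<^sup>2}"
      using square_le_imp_abs_le[of s "s\<^sup>2"] by auto
  qed (auto simp: power2_eq_iff)
  thus ?thesis using assms by simp
qed

text \<open>The classical formula for the number of representations by two squares; the first
  summand accounts for the point \<open>(0, 0)\<close>.\<close>

definition two_square_formula :: "int \<Rightarrow> int" where
  "two_square_formula k = (if k = 0 then 1 else 0) + 4 * chi_sum k"

text \<open>The Liouville identity is applied with \<open>f = chi\<close> and \<open>g = 1\<close>;
  there \<open>chi (e - 2 * i) = chi e * sg i\<close> produces the twisted sum \<open>S\<close>. The
  boundary term \<open>Z\<close> makes up for the difference between the contributions of the
  constant term of the formula to the two sides.\<close>

lemma two_square_formula_recurrence: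
  assumes "n > 0"
  shows "(\<Sum>i\<in>{-n..n}. sg i * two_square_formula (n - i\<^sup>2)) =
    (\<Sum>i\<in>{-n..n}. half_twist two_square_formula (n - i\<^sup>2))"
proof -
  define S where "S = (\<Sum>(i, d, e)\<in>divisor_sols n. sg i * chi e)"
  define Z where "Z = (\<Sum>(i, d, e)\<in>{(i, d, e) \<in> divisor_sols n. e = d + 2 * i}. chi d)"
  define Z' where "Z' = (\<Sum>(i, d, e)\<in>{(i, d, e) \<in> divisor_sols n. e = d - 2 * i}. chi (d + e))"
  define R where "R h = (\<Sum>i\<in>{-n..n}. if n - i\<^sup>2 = 0 then h i else 0)" for h :: "int \<Rightarrow> int"
  have "S = (\<Sum>(i, d, e)\<in>divisor_sols n. sg i * chi d)" unfolding S_def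
    by (rule sum.reindex_bij_witness[where i = "\<lambda>(i, d, e). (i, e, d)" and j = "\<lambda>(i, d, e). (i, e, d)"])
      (auto simp: divisor_sols_def algebra_simps)
  also have "\<dots> = (\<Sum>i\<in>{-n..n}. sg i * chi_sum (n - i\<^sup>2))"
    by (subst sum_divisor_sols[symmetric]) (simp add: chi_sum_def sum_distrib_left split_def)
  finally have S: "S = (\<Sum>i\<in>{-n..n}. sg i * chi_sum (n - i\<^sup>2))" .
  have "2 * (\<Sum>i\<in>{-n..n}. half_twist chi_sum (n - i\<^sup>2)) =
      2 * (\<Sum>(i, d, e)\<in>divisor_sols n. chi (e - 2 * i)) - 2 * Z + Z'"
    unfolding sum_half_twist_chi_sum Z_def Z'_def
    using liouville_identity[of chi "\<lambda>_. 1" n, OF chi_minus] by simp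
  also have "(\<Sum>(i, d, e)\<in>divisor_sols n. chi (e - 2 * i)) = S"
    by (simp add: S_def chi_diff_2_mult mult.commute[of "sg _"])
  \<comment> \<open>On this boundary \<open>d + e = 2 * (d - i)\<close> is even.\<close>
  also have "Z' = 0"
    unfolding Z'_def by (rule sum.neutral) auto
  finally have H: "(\<Sum>i\<in>{-n..n}. half_twist chi_sum (n - i\<^sup>2)) = S - Z" by simp
  have LHS: "(\<Sum>i\<in>{-n..n}. sg i * two_square_formula (n - i\<^sup>2)) = R sg + 4 * S"
    unfolding S R_def two_square_formula_def sum_distrib_left sum.distrib[symmetric]
    by (rule sum.cong) (auto simp: algebra_simps)
  have formula: "half_twist two_square_formula k = (if k = 0 then 1 else 0) + 4 * half_twist chi_sum k" for k
    by (cases "even k") (auto simp: half_twist_def two_square_formula_def sg_def chi_sum_nonpos)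
  have RHS: "(\<Sum>i\<in>{-n..n}. half_twist two_square_formula (n - i\<^sup>2)) = R (\<lambda>_. 1) + 4 * (S - Z)"
    unfolding H[symmetric] R_def sum_distrib_left sum.distrib[symmetric]
    by (simp only: formula)
  \<comment> \<open>Both sides vanish unless \<open>n = s^2\<close>. In that case the roots
    \<open>s\<close> and \<open>- s\<close> give \<open>2 * sg s\<close> on the left and 2 on the
    right, and \<open>Z\<close> is 1 exactly for odd \<open>s\<close>.\<close>
  have "R sg = R (\<lambda>_. 1) - 4 * Z"
  proof (cases "\<exists>s. n = s\<^sup>2")
    case False
    hence "Z = 0" unfolding Z_def by (subst boundary_sols_nonsquare(1)) auto
    moreover have "R h = 0" for h unfolding R_def using False by (intro sum.neutral) auto
    ultimately show ?thesis by simp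
  next
    case True
    then obtain s0 where "n = s0\<^sup>2" by blast
    define s where "s = \<bar>s0\<bar>"
    have s: "s > 0" "n = s\<^sup>2" using \<open>n = s0\<^sup>2\<close> assms by (auto simp: s_def)
    have "Z = (if odd s then 1 else 0)"
      unfolding Z_def s(2) using sum_boundary_sols_square(1)[OF s(1), of "\<lambda>i d e. chi d"]
        sum_chi_odd_interval[OF s(1)] by simp
    moreover have "R h = h s + h (- s)" for h
      unfolding R_def s(2) by (rule sum_roots_of_square[OF s(1)])
    ultimately show ?thesis by (simp add: sg_def)
  qed
  with LHS RHS show ?thesis by simp
qed

text \<open>By linearity the difference \<open>h\<close> of the two sides satisfies the common
  recurrence. For \<open>n > 0\<close> the term \<open>i = 0\<close> on its left is
  \<open>h n\<close>, while all other terms on both sides have arguments below \<open>n\<close>, so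
  strong induction applies. Nonpositive arguments are checked directly.\<close>

theorem card_two_squares: "int (card (two_squares k)) = two_square_formula k"
proof -
  define h where "h k = int (card (two_squares k)) - two_square_formula k" for k
  have nonpos: "h k = 0" if "k \<le> 0" for k
    using that two_squares_neg[of k]
    by (cases "k = 0") (auto simp: h_def two_square_formula_def two_squares_0 chi_sum_nonpos)
  have "h n = 0" for n
  proof (induction "nat n" arbitrary: n rule: less_induct)
    case less
    show ?case
    proof (cases "n > 0")
      case n: True
      have IH: "h k = 0" if "k < n" for k
        using less[of k] nonpos[of k] that n by (cases "k \<le> 0") auto
      have twist: "half_twist h k =
          half_twist (\<lambda>k. int (card (two_squares k))) k - half_twist two_square_formula k" for k
        by (simp add: half_twist_def h_def algebra_simps)
      have "(\<Sum>i\<in>{-n..n}. sg i * h (n - i\<^sup>2)) = (\<Sum>i\<in>{-n..n}. half_twist h (n - i\<^sup>2))"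
        unfolding twist sum_subtractf
        using two_squares_recurrence[of n] two_square_formula_recurrence[OF n]
        by (simp add: h_def right_diff_distrib sum_subtractf)
      also have "\<dots> = 0"
      proof (intro sum.neutral ballI)
        fix i
        have "(n - i\<^sup>2) div 2 < n" using n zero_le_power2[of i] by linarith
        thus "half_twist h (n - i\<^sup>2) = 0" by (simp add: half_twist_def IH)
      qed
      also have "(\<Sum>i\<in>{-n..n}. sg i * h (n - i\<^sup>2)) = (\<Sum>i\<in>{0}. sg i * h (n - i\<^sup>2))"
        by (rule sum.mono_neutral_right) (use n in \<open>auto simp: IH\<close>)
      finally show ?thesis by (simp add: sg_def)
    qed (simp add: nonpos)
  qed
  from this[of k] show ?thesis by (simp add: h_def)
qed

subsection \<open>Dirichlet's involution and sums of four squares\<close>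

definition odd_quads :: "int \<Rightarrow> (int \<times> int \<times> int \<times> int) set" where
  "odd_quads m = {(a, x, b, y). a > 0 \<and> x > 0 \<and> b > 0 \<and> y > 0 \<and>
     odd a \<and> odd x \<and> odd b \<and> odd y \<and> a * x + b * y = 2 * m}"

lemma finite_odd_quads: "finite (odd_quads m)"
proof (rule finite_subset)
  show "odd_quads m \<subseteq> {1..2 * m} \<times> {1..2 * m} \<times> {1..2 * m} \<times> {1..2 * m}"
  proof
    fix p assume "p \<in> odd_quads m"
    then obtain a x b y where p: "p = (a, x, b, y)" "a > 0" "x > 0" "b > 0" "y > 0"
      "a * x + b * y = 2 * m" by (auto simp: odd_quads_def)
    have "a * x > 0" "b * y > 0" using p by auto
    hence "a * x \<le> 2 * m" "b * y \<le> 2 * m" using p(6) by linarith+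
    with mult_le_imp_factors_le[of a x "2 * m"] mult_le_imp_factors_le[of b y "2 * m"] p
    show "p \<in> {1..2 * m} \<times> {1..2 * m} \<times> {1..2 * m} \<times> {1..2 * m}" by auto
  qed
qed simp

lemma chi_mult_chi: "odd b \<Longrightarrow> chi (b + 2 * h) * chi b = sg h"
proof -
  assume "odd b"
  hence "chi b * chi b = 1" unfolding chi_def by (auto; presburger)
  thus ?thesis unfolding chi_add_2_mult by (metis mult.assoc mult.commute mult.right_neutral)
qed

text \<open>With $a = b + 2h$ and $x + y = 2S$ the equation becomes $bS + hx = m$. After reducing $b$
  modulo $2h$, the roles of $(b, h)$ and $(x, S)$ are interchangeable; since $S + h$ is odd,
  the exchange flips the sign.\<close>

lemma sum_odd_quads_greater:
  assumes "odd m"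
  shows "(\<Sum>(a, x, b, y)\<in>{(a, x, b, y) \<in> odd_quads m. a > b}. chi a * chi b) = 0"
proof -
  define P where "P = {(b, S, h, x). b > 0 \<and> h > 0 \<and> odd b \<and> odd x \<and> 0 < x \<and> x < 2 * S
    \<and> b * S + h * x = m}"
  have "(\<Sum>(a, x, b, y)\<in>{(a, x, b, y) \<in> odd_quads m. a > b}. chi a * chi b) = (\<Sum>(b, S, h, x)\<in>P. sg h)"
  proof (rule sum.reindex_bij_witness[where i = "\<lambda>(b, S, h, x). (b + 2 * h, x, b, 2 * S - x)"
        and j = "\<lambda>(a, x, b, y). (b, (x + y) div 2, (a - b) div 2, x)"]; clarsimp)
    fix a x b y assume q: "(a, x, b, y) \<in> odd_quads m" "b < a"
    have "even (x + y)" "even (a - b)" using q by (auto simp: odd_quads_def)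
    then obtain S h where "x + y = 2 * S" "a - b = 2 * h" by (meson evenE)
    hence Sh: "y = 2 * S - x" "a = b + 2 * h" by auto
    show "b + 2 * ((a - b) div 2) = a \<and> 2 * ((x + y) div 2) - x = y" by (simp add: Sh)
    show "(b, (x + y) div 2, (a - b) div 2, x) \<in> P"
      using q by (auto simp: P_def odd_quads_def Sh algebra_simps)
    show "sg ((a - b) div 2) = chi a * chi b"
      using q by (simp add: Sh chi_mult_chi odd_quads_def)
  qed (auto simp: P_def odd_quads_def algebra_simps)
  \<comment> \<open>With \<open>b = 2 * h * k + c\<close> the equation reads
    \<open>2 * h * k * S + c * S + h * x = m\<close>, which is symmetric under exchanging
    \<open>(c, h)\<close> with \<open>(x, S)\<close>. The quotient \<open>k\<close> is kept, so the
    new first entry is \<open>x + 2 * S * k\<close>.\<close>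
  also let ?swap = "\<lambda>(b, S, h, x). (x + 2 * S * (b div (2 * h)), h, S, b mod (2 * h))"
  have "\<dots> = 0"
  proof (rule sum_antisymmetric_eq_0[where h = ?swap])
    fix p assume P: "p \<in> P"
    obtain b S h x where p: "p = (b, S, h, x)" by (cases p)
    define k c where "k = b div (2 * h)" and "c = b mod (2 * h)"
    have b: "b = 2 * h * k + c" unfolding k_def c_def by simp
    have h: "h > 0" "b > 0" "odd b" "odd x" "0 < x" "x < 2 * S" "b * S + h * x = m"
      using P by (auto simp: P_def p)
    have c: "0 \<le> c" "c < 2 * h" using h(1) by (simp_all add: c_def)
    \<comment> \<open>Oddness excludes the remainder 0, so \<open>c\<close> lies strictly between 0
      and \<open>2 * h\<close>, as membership of the image in \<open>P\<close> demands.\<close>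
    have "odd c" using h(3) by (simp add: b)
    hence "c \<noteq> 0" by auto
    have k: "k \<ge> 0" using h(1,2) by (simp add: k_def pos_imp_zdiv_nonneg_iff)
    have *: "(x + 2 * S * k) div (2 * S) = k" "(x + 2 * S * k) mod (2 * S) = x"
      using h by auto
    have "x + 2 * S * k > 0" using h k by (intro add_pos_nonneg) auto
    moreover have swap: "?swap p = (x + 2 * S * k, h, S, c)"
      by (simp add: p k_def c_def)
    ultimately show "?swap p \<in> P"
      using h c \<open>odd c\<close> \<open>c \<noteq> 0\<close> b by (auto simp: P_def algebra_simps)
    show "?swap (?swap p) = p"
      unfolding swap using * b by (simp add: p)
    have "odd (S + h)" using h assms by auto
    thus "(case ?swap p of (b, S, h, x) \<Rightarrow> sg h) = - (case p of (b, S, h, x) \<Rightarrow> sg h)"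
      unfolding swap by (auto simp: p sg_def)
  qed
  finally show ?thesis .
qed

lemma sum_factors_eq_sigma:
  assumes "m > 0"
  shows "(\<Sum>(a, c)\<in>{(a, c). a > 0 \<and> c > 0 \<and> a * c = m}. c) = int (sigma (nat m))"
proof -
  have "int (sigma (nat m)) = (\<Sum>d | d dvd nat m. int d)" by (simp add: sigma_def)
  also have "\<dots> = (\<Sum>(a, c)\<in>{(a, c). a > 0 \<and> c > 0 \<and> a * c = m}. c)"
  proof (rule sum.reindex_bij_witness[where i = "\<lambda>(a, c). nat c" and j = "\<lambda>d. (m div int d, int d)"])
    fix d assume "d \<in> {d. d dvd nat m}"
    hence "int d dvd m" using assms by (metis mem_Collect_eq int_dvd_int_iff int_nat_eq less_imp_le)
    then obtain c where c: "m = int d * c" by blast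
    have "d \<noteq> 0" using c assms by (cases "d = 0") auto
    moreover have "c > 0" using c assms by (simp add: zero_less_mult_iff)
    ultimately show "(m div int d, int d) \<in> {(a, c). a > 0 \<and> c > 0 \<and> a * c = m}"
      using c by simp
  qed (auto simp: nat_dvd_iff)
  finally show ?thesis by simp
qed

text \<open>For \<open>a = b\<close> each term is 1, and the equation becomes
  \<open>a * c = m\<close> with \<open>x + y = 2 * c\<close>. There are \<open>c\<close> odd values
  of \<open>x\<close> between 1 and \<open>2 * c - 1\<close>, so the count is the sum of the
  divisors \<open>c\<close> of \<open>m\<close>.\<close>

lemma sum_odd_quads_equal:
  assumes "odd m" "m > 0"
  shows "(\<Sum>(a, x, b, y)\<in>{(a, x, b, y) \<in> odd_quads m. a = b}. chi a * chi b) = int (sigma (nat m))"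
proof -
  let ?F = "{(a::int, c). a > 0 \<and> c > 0 \<and> a * c = m}"
  have "(\<Sum>(a, x, b, y)\<in>{(a, x, b, y) \<in> odd_quads m. a = b}. chi a * chi b) =
    (\<Sum>(p, j)\<in>(SIGMA p:?F. {0..<snd p}). 1)"
  proof (rule sum.reindex_bij_witness[where i = "\<lambda>((a, c), j). (a, 2 * j + 1, a, 2 * c - 2 * j - 1)"
        and j = "\<lambda>(a, x, b, y). ((a, (x + y) div 2), (x - 1) div 2)"])
    fix p assume p: "p \<in> {(a, x, b, y) \<in> odd_quads m. a = b}"
    then obtain a x y where q: "p = (a, x, a, y)" "a > 0" "odd a" "x > 0" "y > 0" "odd x" "odd y"
      "a * x + a * y = 2 * m"
      by (auto simp: odd_quads_def)
    have "even (x + y)" "even (x - 1)" using q by auto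
    then obtain c j where "x + y = 2 * c" "x - 1 = 2 * j" by (meson evenE)
    hence xy: "x = 2 * j + 1" "y = 2 * c - 2 * j - 1" by auto
    have "a * c = m" using q(8) by (simp add: xy algebra_simps)
    moreover have "chi a * chi a = 1" using chi_mult_chi[of a 0] q by (simp add: sg_def)
    moreover have "p = (a, 2 * j + 1, a, 2 * c - 2 * j - 1)" "0 \<le> j" "j < c"
      using q by (auto simp: xy)
    ultimately show "(\<lambda>((a, c), j). (a, 2 * j + 1, a, 2 * c - 2 * j - 1))
          ((\<lambda>(a, x, b, y). ((a, (x + y) div 2), (x - 1) div 2)) p) = p"
      and "(\<lambda>(a, x, b, y). ((a, (x + y) div 2), (x - 1) div 2)) p \<in> (SIGMA p:?F. {0..<snd p})"
      and "(\<lambda>(p, j). 1) ((\<lambda>(a, x, b, y). ((a, (x + y) div 2), (x - 1) div 2)) p) =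
          (case p of (a, x, b, y) \<Rightarrow> chi a * chi b)"
      using q(2) by auto
  qed (use assms in \<open>auto simp: odd_quads_def algebra_simps\<close>)
  also have "\<dots> = (\<Sum>p\<in>?F. snd p)"
    by (subst sum.Sigma[symmetric]) (auto simp: finite_factorizations intro!: sum.cong)
  also have "\<dots> = int (sigma (nat m))"
    using sum_factors_eq_sigma[OF assms(2)] by (simp add: split_def)
  finally show ?thesis .
qed

theorem sum_odd_quads:
  assumes "odd m" "m > 0"
  shows "(\<Sum>(a, x, b, y)\<in>odd_quads m. chi a * chi b) = int (sigma (nat m))"
proof -
  let ?f = "\<lambda>(a, x, b, y). chi a * chi b"
  let ?G = "{(a, x, b, y) \<in> odd_quads m. a > b}" and ?L = "{(a, x, b, y) \<in> odd_quads m. a < b}"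
    and ?E = "{(a, x, b, y) \<in> odd_quads m. a = b}"
  have fin: "finite ?G" "finite ?L" "finite ?E"
    by (rule finite_subset[OF _ finite_odd_quads[of m]]; auto)+
  have "odd_quads m = ?G \<union> ?L \<union> ?E" by auto
  hence "sum ?f (odd_quads m) = sum ?f (?G \<union> ?L \<union> ?E)" by (rule arg_cong)
  also have "\<dots> = sum ?f (?G \<union> ?L) + sum ?f ?E"
    using fin by (intro sum.union_disjoint) auto
  also have "sum ?f (?G \<union> ?L) = sum ?f ?G + sum ?f ?L"
    using fin by (intro sum.union_disjoint) auto
  also have "sum ?f ?L = sum ?f ?G"
    by (rule sum.reindex_bij_witness[where i = "\<lambda>(a, x, b, y). (b, y, a, x)"
          and j = "\<lambda>(a, x, b, y). (b, y, a, x)"]) (auto simp: odd_quads_def algebra_simps)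
  finally show ?thesis
    using sum_odd_quads_greater[OF assms(1)] sum_odd_quads_equal[OF assms] by simp
qed

section \<open>The number of representations by four squares\<close>

definition odd_even_squares :: "int \<Rightarrow> (int \<times> int) set" where
  "odd_even_squares u = {(p, q). odd p \<and> even q \<and> p\<^sup>2 + q\<^sup>2 = u}"

definition four_squares :: "int \<Rightarrow> (int \<times> int \<times> int \<times> int) set" where
  "four_squares m = {(p, q, r, s). odd p \<and> even q \<and> odd r \<and> even s \<and> p\<^sup>2 + q\<^sup>2 + r\<^sup>2 + s\<^sup>2 = 2 * m}"

lemma finite_odd_even_squares: "finite (odd_even_squares u)"
  by (rule finite_subset[OF _ finite_two_squares[of u]]) (auto simp: odd_even_squares_def two_squares_def)

text \<open>For odd \<open>u\<close> exactly one coordinate is odd, so exchanging the coordinates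
  shows that this is half the number of all representations.\<close>

lemma card_odd_even_squares:
  assumes "odd u"
  shows "int (card (odd_even_squares u)) = 2 * chi_sum u"
proof -
  let ?swap = "\<lambda>(p::int, q::int). (q, p)"
  have inj: "inj_on ?swap (odd_even_squares u)" by (auto simp: inj_on_def)
  have "two_squares u = odd_even_squares u \<union> ?swap ` odd_even_squares u"
  proof
    show "two_squares u \<subseteq> odd_even_squares u \<union> ?swap ` odd_even_squares u"
    proof clarify
      fix p q assume pq: "(p, q) \<in> two_squares u" "(p, q) \<notin> ?swap ` odd_even_squares u"
      have "odd (p\<^sup>2 + q\<^sup>2)" using pq assms by (auto simp: two_squares_def)
      moreover have "(q, p) \<notin> odd_even_squares u" using pq(2) by force
      ultimately show "(p, q) \<in> odd_even_squares u"
        using pq(1) by (auto simp: two_squares_def odd_even_squares_def)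
    qed
  qed (auto simp: two_squares_def odd_even_squares_def)
  moreover have "odd_even_squares u \<inter> ?swap ` odd_even_squares u = {}"
    by (auto simp: odd_even_squares_def)
  ultimately have "card (two_squares u) = card (odd_even_squares u) + card (?swap ` odd_even_squares u)"
    by (simp add: card_Un_disjoint finite_odd_even_squares)
  also have "card (?swap ` odd_even_squares u) = card (odd_even_squares u)"
    by (rule card_image[OF inj])
  finally have "2 * int (card (odd_even_squares u)) = int (card (two_squares u))" by simp
  also have "\<dots> = 4 * chi_sum u"
    using assms by (auto simp: card_two_squares two_square_formula_def)
  finally show ?thesis by simp
qed

text \<open>Splits a solution by \<open>u = p^2 + q^2\<close>. The bounds on \<open>u\<close> are
  strict because \<open>p^2\<close> and \<open>r^2\<close> are squares of odd numbers, hence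
  positive.\<close>

lemma bij_betw_four_squares:
  "bij_betw (\<lambda>(p, q, r, s). (p\<^sup>2 + q\<^sup>2, (p, q), (r, s))) (four_squares m)
    (SIGMA u:({0<..<2 * m} \<inter> Collect odd). odd_even_squares u \<times> odd_even_squares (2 * m - u))"
proof (rule bij_betw_byWitness[where f' = "\<lambda>(u, (p, q), (r, s)). (p, q, r, s)"])
  show "(\<lambda>(p, q, r, s). (p\<^sup>2 + q\<^sup>2, (p, q), (r, s))) ` four_squares m \<subseteq>
    (SIGMA u:({0<..<2 * m} \<inter> Collect odd). odd_even_squares u \<times> odd_even_squares (2 * m - u))"
  proof (rule image_subsetI)
    fix v assume v: "v \<in> four_squares m"
    obtain p q r s where pqrs: "v = (p, q, r, s)" by (cases v)
    have *: "odd p" "even q" "odd r" "even s" "p\<^sup>2 + q\<^sup>2 + r\<^sup>2 + s\<^sup>2 = 2 * m"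
      using v by (auto simp: four_squares_def pqrs)
    have "p\<^sup>2 > 0" "r\<^sup>2 > 0" using * by auto
    hence "p\<^sup>2 + q\<^sup>2 > 0" "r\<^sup>2 + s\<^sup>2 > 0" by (auto intro: add_pos_nonneg)
    thus "(case v of (p, q, r, s) \<Rightarrow> (p\<^sup>2 + q\<^sup>2, (p, q), (r, s))) \<in>
        (SIGMA u:({0<..<2 * m} \<inter> Collect odd). odd_even_squares u \<times> odd_even_squares (2 * m - u))"
      using * by (auto simp: odd_even_squares_def pqrs)
  qed
qed (auto simp: four_squares_def odd_even_squares_def)

lemma finite_four_squares: "finite (four_squares m)"
  using bij_betw_finite[OF bij_betw_four_squares[of m]]
  by (simp add: finite_odd_even_squares)

text \<open>Expand both divisor sums with \<open>u = a * x\<close> and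
  \<open>2 * m - u = b * y\<close>. Since \<open>u\<close> is odd, so is \<open>2 * m - u\<close>,
  and all four factors are odd.\<close>

lemma sum_odd_quads_eq_chi_sum:
  "(\<Sum>(a, x, b, y)\<in>odd_quads m. chi a * chi b) =
   (\<Sum>u\<in>({0<..<2 * m} \<inter> Collect odd). chi_sum u * chi_sum (2 * m - u))"
proof -
  let ?F = "\<lambda>k. {(d::int, e). d > 0 \<and> e > 0 \<and> d * e = k}"
  have "(\<Sum>(a, x, b, y)\<in>odd_quads m. chi a * chi b) =
    (\<Sum>(u, v)\<in>(SIGMA u:({0<..<2 * m} \<inter> Collect odd). ?F u \<times> ?F (2 * m - u)). chi (fst (fst v)) * chi (fst (snd v)))"
  proof (rule sum.reindex_bij_witness[where i = "\<lambda>(u, (a, x), (b, y)). (a, x, b, y)"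
        and j = "\<lambda>(a, x, b, y). (a * x, (a, x), (b, y))"])
    fix p assume p: "p \<in> odd_quads m"
    obtain a x b y where q: "p = (a, x, b, y)" by (cases p)
    have *: "a > 0" "x > 0" "b > 0" "y > 0" "odd a" "odd x" "a * x + b * y = 2 * m"
      using p by (auto simp: odd_quads_def q)
    hence "a * x > 0" "b * y > 0" by auto
    hence "a * x < 2 * m" using *(7) by linarith
    with * show "(case p of (a, x, b, y) \<Rightarrow> (a * x, (a, x), (b, y))) \<in>
        (SIGMA u:({0<..<2 * m} \<inter> Collect odd). ?F u \<times> ?F (2 * m - u))"
      by (simp add: q)
  next
    fix p assume p: "p \<in> (SIGMA u:({0<..<2 * m} \<inter> Collect odd). ?F u \<times> ?F (2 * m - u))"
    obtain u a x b y where q: "p = (u, (a, x), (b, y))" by (cases p) auto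
    have *: "u = a * x" "odd (a * x)" "b * y = 2 * m - a * x" "a > 0" "x > 0" "b > 0" "y > 0"
      using p by (auto simp: q)
    have "odd (b * y)" using *(2) unfolding *(3) by simp
    hence "odd b" "odd y" by auto
    with * show "(\<lambda>(u, (a, x), (b, y)). (a, x, b, y)) p \<in> odd_quads m"
      and "(\<lambda>(a, x, b, y). (a * x, (a, x), (b, y))) ((\<lambda>(u, (a, x), (b, y)). (a, x, b, y)) p) = p"
      by (auto simp: odd_quads_def q)
  qed auto
  also have "\<dots> = (\<Sum>u\<in>({0<..<2 * m} \<inter> Collect odd). \<Sum>v\<in>?F u \<times> ?F (2 * m - u). chi (fst (fst v)) * chi (fst (snd v)))"
    by (rule sum.Sigma[symmetric]) (auto simp: finite_factorizations)
  also have "\<dots> = (\<Sum>u\<in>({0<..<2 * m} \<inter> Collect odd). chi_sum u * chi_sum (2 * m - u))"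
    by (rule sum.cong) (auto simp: chi_sum_def sum_product sum.cartesian_product split_def)
  finally show ?thesis .
qed

theorem card_four_squares:
  assumes "odd m" "m > 0"
  shows "int (card (four_squares m)) = 4 * int (sigma (nat m))"
proof -
  have "int (card (four_squares m)) =
    (\<Sum>u\<in>({0<..<2 * m} \<inter> Collect odd). int (card (odd_even_squares u)) * int (card (odd_even_squares (2 * m - u))))"
    using bij_betw_same_card[OF bij_betw_four_squares[of m]]
    by (simp add: finite_odd_even_squares card_cartesian_product)
  also have "\<dots> = (\<Sum>u\<in>({0<..<2 * m} \<inter> Collect odd). 4 * (chi_sum u * chi_sum (2 * m - u)))"
    by (rule sum.cong) (auto simp: card_odd_even_squares)
  also have "\<dots> = 4 * (\<Sum>(a, x, b, y)\<in>odd_quads m. chi a * chi b)"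
    unfolding sum_odd_quads_eq_chi_sum sum_distrib_left ..
  finally show ?thesis using sum_odd_quads[OF assms] by simp
qed

subsection \<open>The eta-cube identity\<close>

lemma odd_square_mod_8:
  fixes a :: int
  assumes "odd a"
  shows "a\<^sup>2 mod 8 = 1"
proof -
  obtain k where k: "a = 2 * k + 1" using assms by (rule oddE)
  have "even (k * (k + 1))" by simp
  then obtain j where "k * (k + 1) = 2 * j" by blast
  hence "a\<^sup>2 = 8 * j + 1" by (simp add: k power2_eq_square algebra_simps)
  thus ?thesis by simp
qed

lemma sum_even_interval:
  fixes h :: "int \<Rightarrow> int"
  shows "(\<Sum>d\<in>{1..2 * s - 1}. if even d then h (d div 2) else 0) = (\<Sum>k\<in>{1..s - 1}. h k)"
proof -
  have "(\<Sum>d\<in>{1..2 * s - 1}. if even d then h (d div 2) else 0) =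
    (\<Sum>d\<in>{1..2 * s - 1} \<inter> Collect even. h (d div 2))"
    by (rule sum.mono_neutral_cong_right) auto
  also have "\<dots> = (\<Sum>k\<in>{1..s - 1}. h k)"
    by (rule sum.reindex_bij_witness[where i = "\<lambda>k. 2 * k" and j = "\<lambda>d. d div 2"]) auto
  finally show ?thesis .
qed

definition sols_1_8 :: "int \<Rightarrow> (int \<times> int \<times> int) set" where
  "sols_1_8 M = {(a, d, e). odd a \<and> d > 0 \<and> e > 0 \<and> M = a\<^sup>2 + 8 * (d * e)}"

text \<open>For odd \<open>i\<close> the product \<open>d * e\<close> is divisible by 8. The terms
  that survive have \<open>d = 2 * d'\<close> and \<open>e = 2 * e'\<close> with exactly one of
  \<open>d'\<close>, \<open>e'\<close> even; symmetry gives the factor 2. In the case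
  \<open>d = 2 * d'\<close>, \<open>e = 4 * e''\<close> the term is
  \<open>chi (d' + 2 * e'') = chi d' * sg e''\<close>.\<close>

lemma sum_sols_1_8:
  fixes f g :: "int \<Rightarrow> int"
  assumes M: "M mod 8 = 1"
  defines "f \<equiv> \<lambda>x. if even x then chi (x div 2) else 0" and "g \<equiv> \<lambda>y. if odd y then 1 else 0"
  shows "2 * (\<Sum>(a, d, e)\<in>sols_1_8 M. chi d * sg e) = (\<Sum>(i, d, e)\<in>divisor_sols M. f (d + e) * g i)"
proof -
  let ?h = "\<lambda>(i, d, e). if odd i \<and> even d \<and> 4 dvd e then chi ((d + e) div 2) else 0"
  let ?h' = "\<lambda>(i, d, e). if odd i \<and> even e \<and> 4 dvd d then chi ((d + e) div 2) else 0"
  have "(\<Sum>(i, d, e)\<in>divisor_sols M. f (d + e) * g i) = (\<Sum>p\<in>divisor_sols M. ?h p + ?h' p)"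
  proof (rule sum.cong)
    fix p assume p: "p \<in> divisor_sols M"
    obtain i d e where ide: "p = (i, d, e)" by (cases p)
    have M': "M = i\<^sup>2 + d * e" using p by (simp add: ide divisor_sols_def)
    have "f (d + e) * g i = ?h (i, d, e) + ?h' (i, d, e)"
    proof (cases "odd i")
      case True
      have "(d * e) mod 8 = (M - i\<^sup>2) mod 8" using M' by simp
      also have "\<dots> = 0" using M odd_square_mod_8[OF True] by presburger
      finally have de: "8 dvd d * e" by auto
      show ?thesis
      proof (cases "even d \<and> even e")
        case True
        then obtain d' e' where d': "d = 2 * d'" "e = 2 * e'" by (meson evenE)
        have "(2 * 4) dvd 4 * (d' * e')" using de by (simp add: d' mult.assoc mult.left_commute)
        hence "even (d' * e')" by (metis dvd_times_left_cancel_iff mult.commute zero_neq_numeral)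
        moreover have "4 dvd 2 * e' \<longleftrightarrow> even e'" "4 dvd 2 * d' \<longleftrightarrow> even d'" by presburger+
        moreover have "(2 * d' + 2 * e') div 2 = d' + e'" by simp
        ultimately show ?thesis using \<open>odd i\<close>
          by (cases "even d'"; cases "even e'") (simp_all add: f_def g_def d')
      next
        case False
        have "even (d * e)" using de by (meson dvd_trans dvd_triv_left even_numeral)
        hence "odd (d + e)" using False by auto
        thus ?thesis using False by (auto simp: f_def)
      qed
    qed (auto simp: g_def)
    thus "(case p of (i, d, e) \<Rightarrow> f (d + e) * g i) = ?h p + ?h' p" by (simp add: ide)
  qed simp
  also have "\<dots> = sum ?h (divisor_sols M) + sum ?h' (divisor_sols M)" by (rule sum.distrib)
  also have "sum ?h' (divisor_sols M) = sum ?h (divisor_sols M)"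
    by (rule sum.reindex_bij_witness[where i = "\<lambda>(i, d, e). (i, e, d)" and j = "\<lambda>(i, d, e). (i, e, d)"])
      (auto simp: divisor_sols_def algebra_simps)
  also have "sum ?h (divisor_sols M) =
    (\<Sum>(i, d, e)\<in>{(i, d, e) \<in> divisor_sols M. odd i \<and> even d \<and> 4 dvd e}. chi ((d + e) div 2))"
    by (rule sum.mono_neutral_cong_right) (auto simp: finite_divisor_sols split: if_splits)
  also have "\<dots> = (\<Sum>(a, d, e)\<in>sols_1_8 M. chi d * sg e)"
    by (rule sum.reindex_bij_witness[where i = "\<lambda>(a, d, e). (a, 2 * d, 4 * e)"
          and j = "\<lambda>(i, d, e). (i, d div 2, e div 4)"])
      (auto simp: divisor_sols_def sols_1_8_def algebra_simps chi_add_2_mult[symmetric])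
  finally show ?thesis by simp
qed

text \<open>The main sum on the right of the Liouville identity cancels under \<open>i\<close> ->
  \<open>- i\<close>. Only \<open>e = 2 * k\<close> matters, and then \<open>i\<close> is odd. For
  odd \<open>k\<close> both \<open>chi (k + i)\<close> and \<open>chi (k - i)\<close> vanish; for
  even \<open>k\<close>, \<open>k + i\<close> differs from \<open>i - k\<close> by a multiple of 4,
  so the values are opposite.\<close>

lemma sum_sols_1_8_eq_boundary:
  fixes f g :: "int \<Rightarrow> int"
  assumes M: "M mod 8 = 1"
  defines "f \<equiv> \<lambda>x. if even x then chi (x div 2) else 0" and "g \<equiv> \<lambda>y. if odd y then 1 else 0"
  shows "2 * (\<Sum>(a, d, e)\<in>sols_1_8 M. chi d * sg e) =
    - 2 * (\<Sum>(i, d, e)\<in>{(i, d, e) \<in> divisor_sols M. e = d + 2 * i}. f d * g (d + i))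
    + (\<Sum>(i, d, e)\<in>{(i, d, e) \<in> divisor_sols M. e = d - 2 * i}. f (d + e) * g i)"
proof -
  have f: "f (- x) = - f x" for x
  proof (cases "even x")
    case True
    then obtain y where "x = 2 * y" by blast
    moreover have "- (2 * y) div 2 = - y" by presburger
    ultimately show ?thesis by (simp add: f_def chi_minus)
  qed (simp add: f_def)
  have g: "g (- y) = g y" for y by (simp add: g_def)
  have "(\<Sum>(i, d, e)\<in>divisor_sols M. f (e - 2 * i) * g (d + i)) = 0"
  proof (rule sum_antisymmetric_eq_0[where h = "\<lambda>(i, d, e). (- i, d, e)"])
    fix p assume p: "p \<in> divisor_sols M"
    obtain i d e where ide: "p = (i, d, e)" by (cases p)
    have M': "M = i\<^sup>2 + d * e" using p by (simp add: ide divisor_sols_def)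
    have "odd M" using M by presburger
    have "f (e + 2 * i) * g (d - i) = - (f (e - 2 * i) * g (d + i))"
    proof (cases "even e")
      case True
      then obtain k where k: "e = 2 * k" by blast
      have "odd i" using \<open>odd M\<close> by (simp add: M' k)
      have "chi (k + i) = - chi (k - i)"
      proof (cases "even k")
        case True
        have "chi (k + i) = chi ((i - k) + 2 * k)" by (simp add: algebra_simps)
        also have "\<dots> = - chi (- (i - k))" unfolding chi_add_2_mult chi_minus using True by (simp add: sg_def)
        finally show ?thesis by simp
      qed (use \<open>odd i\<close> in auto)
      moreover have "f (e + 2 * i) = chi (k + i)" "f (e - 2 * i) = chi (k - i)"
        unfolding f_def k by simp_all
      ultimately show ?thesis by (simp add: g_def)
    qed (simp add: f_def)
    thus "(\<lambda>(i, d, e). f (e - 2 * i) * g (d + i)) ((\<lambda>(i, d, e). (- i, d, e)) p) =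
        - (\<lambda>(i, d, e). f (e - 2 * i) * g (d + i)) p"
      by (simp add: ide)
  qed (auto simp: divisor_sols_def)
  with liouville_identity[of f g M, OF f g] sum_sols_1_8[OF M] show ?thesis
    by (simp add: f_def g_def)
qed

lemma sum_sols_1_8_nonsquare:
  assumes "M mod 8 = 1" "\<And>s. M \<noteq> s\<^sup>2"
  shows "(\<Sum>(a, d, e)\<in>sols_1_8 M. chi d * sg e) = 0"
proof -
  note empty = boundary_sols_nonsquare[of M, OF assms(2)]
  show ?thesis
    using sum_sols_1_8_eq_boundary[OF assms(1)] unfolding empty by simp
qed

text \<open>The first boundary sum is the sum of \<open>chi\<close> up to \<open>s - 1\<close>,
  which is 1 if \<open>s\<close> is 3 modulo 4 and 0 otherwise. On the second,
  \<open>d + e = 2 * s\<close>, and each of the \<open>s - 1\<close> even values of \<open>d\<close>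
  contributes \<open>chi s\<close>. In both residue classes the combination is
  \<open>chi s * s - 1\<close>.\<close>

lemma sum_sols_1_8_square:
  assumes "s > 0" "odd s"
  shows "2 * (\<Sum>(a, d, e)\<in>sols_1_8 (s\<^sup>2). chi d * sg e) = chi s * s - 1"
proof -
  let ?f = "\<lambda>x. if even x then chi (x div 2) else 0" and ?g = "\<lambda>y::int. if odd y then 1 else (0::int)"
  have "(\<Sum>(i, d, e)\<in>{(i, d, e) \<in> divisor_sols (s\<^sup>2). e = d + 2 * i}. ?f d * ?g (d + i)) =
    (\<Sum>d\<in>{1..2 * s - 1}. ?f d)"
    using sum_boundary_sols_square(1)[OF assms(1), of "\<lambda>i d e. ?f d * ?g (d + i)"] assms(2) by simp
  also have "\<dots> = (\<Sum>k\<in>{1..s - 1}. chi k)" by (rule sum_even_interval)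
  also have "\<dots> = (if s mod 4 = 3 then 1 else 0)"
  proof -
    obtain j where j: "s = 2 * j + 1" using assms(2) by (rule oddE)
    define i where "i = nat j"
    have i: "s - 1 = int (2 * i)" "s = 2 * int i + 1" using j assms(1) by (auto simp: i_def)
    have "((2 * i) mod 4 = 1 \<or> (2 * i) mod 4 = 2) \<longleftrightarrow> s mod 4 = 3"
      unfolding i(2) by presburger
    thus ?thesis unfolding i(1) sum_chi_interval by simp
  qed
  finally have Z: "(\<Sum>(i, d, e)\<in>{(i, d, e) \<in> divisor_sols (s\<^sup>2). e = d + 2 * i}. ?f d * ?g (d + i)) =
    (if s mod 4 = 3 then 1 else 0)" .
  have "(\<Sum>(i, d, e)\<in>{(i, d, e) \<in> divisor_sols (s\<^sup>2). e = d - 2 * i}. ?f (d + e) * ?g i) =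
    (\<Sum>d\<in>{1..2 * s - 1}. if even d then (\<lambda>_. chi s) (d div 2) else 0)"
    unfolding sum_boundary_sols_square(2)[OF assms(1), of "\<lambda>i d e. ?f (d + e) * ?g i"]
    by (rule sum.cong) (use assms(2) in auto)
  also have "\<dots> = (s - 1) * chi s"
    using sum_even_interval[where h = "\<lambda>_. chi s"] assms by simp
  finally have Z': "(\<Sum>(i, d, e)\<in>{(i, d, e) \<in> divisor_sols (s\<^sup>2). e = d - 2 * i}. ?f (d + e) * ?g i) =
    (s - 1) * chi s" .
  have "s mod 4 = 1 \<or> s mod 4 = 3" using assms(2) by presburger
  thus ?thesis
    unfolding sum_sols_1_8_eq_boundary[OF odd_square_mod_8[OF assms(2)]] Z Z'
    by (auto simp: chi_def algebra_simps)
qed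

section \<open>The signed sum over \<open>M = a^2 + 4 * (b^2 + e^2)\<close>\<close>

definition sols_1_4_4 :: "int \<Rightarrow> (int \<times> int \<times> int) set" where
  "sols_1_4_4 M = {(a, b, e). odd a \<and> M = a\<^sup>2 + 4 * (b\<^sup>2 + e\<^sup>2)}"

lemma sols_1_4_4_eq_Sigma:
  assumes "M mod 4 = 1"
  shows "sols_1_4_4 M =
    (SIGMA a:{-M..M} \<inter> Collect odd. two_squares ((M - a\<^sup>2) div 4))"
proof -
  have "(a, b, e) \<in> sols_1_4_4 M \<longleftrightarrow>
      (a, b, e) \<in> (SIGMA a:{-M..M} \<inter> Collect odd. two_squares ((M - a\<^sup>2) div 4))" for a b e
  proof (cases "odd a")
    case True
    have eq: "M = a\<^sup>2 + 4 * (b\<^sup>2 + e\<^sup>2) \<longleftrightarrow> b\<^sup>2 + e\<^sup>2 = (M - a\<^sup>2) div 4"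
      using odd_square_mod_8[OF True] assms by presburger
    have "-M \<le> a \<and> a \<le> M" if "M = a\<^sup>2 + 4 * (b\<^sup>2 + e\<^sup>2)"
      by (rule square_le_imp_abs_le) (simp add: that)
    thus ?thesis
      using True unfolding sols_1_4_4_def two_squares_def mem_Sigma_iff mem_Collect_eq prod.case eq
      by auto
  qed (simp add: sols_1_4_4_def)
  thus ?thesis by (intro set_eqI) (simp only: split_paired_all)
qed

lemma finite_sols_1_4_4: "M mod 4 = 1 \<Longrightarrow> finite (sols_1_4_4 M)"
  by (simp add: sols_1_4_4_eq_Sigma finite_two_squares)

lemma sg_mult_chi_sum:
  "sg k * chi_sum k = (\<Sum>(d, e)\<in>{(d, e). d > 0 \<and> e > 0 \<and> d * e = k}. chi d * sg e)"
  unfolding chi_sum_def sum_distrib_left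
  by (rule sum.cong) (auto simp: chi_mult_sg mult.commute[of "sg _"])

lemma sum_chi_sum_sols_1_8:
  assumes "M mod 8 = 1"
  shows "(\<Sum>a\<in>{-M..M} \<inter> Collect odd. sg ((M - a\<^sup>2) div 8) * chi_sum ((M - a\<^sup>2) div 8)) =
    (\<Sum>(a, d, e)\<in>sols_1_8 M. chi d * sg e)"
proof -
  have "(a, d, e) \<in> sols_1_8 M \<longleftrightarrow> (a, d, e) \<in> (SIGMA a:{-M..M} \<inter> Collect odd.
      {(d, e). d > 0 \<and> e > 0 \<and> d * e = (M - a\<^sup>2) div 8})" for a d e
  proof (cases "odd a")
    case True
    have "(M - a\<^sup>2) mod 8 = 0" using odd_square_mod_8[OF True] assms by presburger
    then obtain k where k: "M - a\<^sup>2 = 8 * k" by blast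
    hence eq: "M = a\<^sup>2 + 8 * (d * e) \<longleftrightarrow> d * e = (M - a\<^sup>2) div 8" by auto
    have "-M \<le> a \<and> a \<le> M" if "d > 0" "e > 0" "M = a\<^sup>2 + 8 * (d * e)"
      by (rule square_le_imp_abs_le) (use that in simp)
    thus ?thesis
      using True unfolding sols_1_8_def mem_Sigma_iff mem_Collect_eq prod.case eq by auto
  qed (simp add: sols_1_8_def)
  hence "sols_1_8 M = (SIGMA a:{-M..M} \<inter> Collect odd.
      {(d, e). d > 0 \<and> e > 0 \<and> d * e = (M - a\<^sup>2) div 8})"
    by (intro set_eqI) (simp only: split_paired_all)
  hence "(\<Sum>(a, d, e)\<in>sols_1_8 M. chi d * sg e) =
    (\<Sum>a\<in>{-M..M} \<inter> Collect odd. \<Sum>(d, e)\<in>{(d, e). d > 0 \<and> e > 0 \<and> d * e = (M - a\<^sup>2) div 8}. chi d * sg e)"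
    by (subst sum.Sigma) (auto simp: finite_factorizations)
  also have "\<dots> = (\<Sum>a\<in>{-M..M} \<inter> Collect odd. sg ((M - a\<^sup>2) div 8) * chi_sum ((M - a\<^sup>2) div 8))"
    unfolding sg_mult_chi_sum ..
  finally show ?thesis by simp
qed

text \<open>Exactly one of \<open>s\<close> and \<open>- s\<close> is 1 modulo 4, namely
  \<open>chi s * s\<close>.\<close>

lemma sum_roots_1_mod_4:
  fixes s :: int
  assumes "odd s"
  shows "(\<Sum>r\<in>{r. r\<^sup>2 = s\<^sup>2 \<and> 4 dvd r - 1}. r) = chi s * s"
proof -
  have "{r. r\<^sup>2 = s\<^sup>2 \<and> 4 dvd r - 1} = {chi s * s}"
  proof (cases "s mod 4 = 1")
    case True
    moreover have "4 dvd s - 1" "\<not> 4 dvd - s - 1" using True by presburger+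
    ultimately show ?thesis by (auto simp: power2_eq_iff chi_def)
  next
    case False
    hence *: "s mod 4 = 3" using assms by presburger
    moreover have "\<not> 4 dvd s - 1" "4 dvd - s - 1" using * by presburger+
    ultimately show ?thesis by (auto simp: power2_eq_iff chi_def)
  qed
  thus ?thesis by simp
qed

text \<open>The coefficient form of the eta-cube identity
  $\varphi(q)\,\varphi(-q)\,\psi(q^2) = \sum_{r \equiv 1 (4)} r q^{(r^2-1)/4}$.\<close>

theorem sum_sols_1_4_4:
  assumes "M mod 4 = 1"
  shows "(\<Sum>(a, b, e)\<in>sols_1_4_4 M. sg b) = 2 * (\<Sum>r\<in>{r. r\<^sup>2 = M \<and> 4 dvd r - 1}. r)"
proof -
  let ?A = "{-M..M} \<inter> Collect odd"
  let ?k = "\<lambda>a. (M - a\<^sup>2) div 4"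
  have "(\<Sum>(a, b, e)\<in>sols_1_4_4 M. sg b) = (\<Sum>a\<in>?A. \<Sum>(b, e)\<in>two_squares (?k a). sg b)"
    unfolding sols_1_4_4_eq_Sigma[OF assms]
    by (subst sum.Sigma) (auto simp: finite_two_squares)
  also have "\<dots> = (\<Sum>a\<in>?A. if even (?k a) then sg (?k a div 2) * two_square_formula (?k a div 2) else 0)"
    unfolding sum_sg_two_squares card_two_squares ..
  finally have LHS: "(\<Sum>(a, b, e)\<in>sols_1_4_4 M. sg b) = \<dots>" .
  show ?thesis
  proof (cases "M mod 8 = 1")
    case False
    \<comment> \<open>For odd \<open>a\<close> the number \<open>(M - a^2) div 4\<close> is now odd,
      so the sum over each slice vanishes; the right side is empty because odd squares are 1 modulo
      8.\<close>
    hence M: "M mod 8 = 5" using assms by presburger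
    have "(\<Sum>(a, b, e)\<in>sols_1_4_4 M. sg b) = 0"
      unfolding LHS
    proof (intro sum.neutral ballI)
      fix a assume "a \<in> ?A"
      hence "a\<^sup>2 mod 8 = 1" using odd_square_mod_8[of a] by simp
      hence "odd (?k a)" using M by presburger
      thus "(if even (?k a) then sg (?k a div 2) * two_square_formula (?k a div 2) else 0) = 0" by simp
    qed
    moreover have "r\<^sup>2 \<noteq> M" for r
    proof
      assume r: "r\<^sup>2 = M"
      have "odd (r\<^sup>2)" using M unfolding r by presburger
      hence "odd r" by simp
      thus False using odd_square_mod_8[of r] M r by simp
    qed
    ultimately show ?thesis by simp
  next
    case M: True
    let ?j = "\<lambda>a. (M - a\<^sup>2) div 8"
    let ?K = "\<Sum>(a, d, e)\<in>sols_1_8 M. chi d * sg e"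
    have twisted_formula: "sg k * two_square_formula k = (if k = 0 then 1 else 0) + 4 * (sg k * chi_sum k)" for k
      by (simp add: two_square_formula_def chi_sum_nonpos sg_def)
    let ?R = "\<Sum>a\<in>{-M..M}. if M - a\<^sup>2 = 0 then 1 else (0::int)"
    have "(\<Sum>(a, b, e)\<in>sols_1_4_4 M. sg b) =
      (\<Sum>a\<in>?A. (if M - a\<^sup>2 = 0 then 1 else 0) + 4 * (sg (?j a) * chi_sum (?j a)))"
      unfolding LHS
    proof (rule sum.cong)
      fix a assume "a \<in> ?A"
      hence "a\<^sup>2 mod 8 = 1" using odd_square_mod_8[of a] by simp
      hence "(M - a\<^sup>2) mod 8 = 0" using M by presburger
      then obtain k where k: "M - a\<^sup>2 = 8 * k" by blast
      have *: "even (?k a)" "?k a div 2 = ?j a" "?j a = 0 \<longleftrightarrow> M - a\<^sup>2 = 0"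
        unfolding k by simp_all
      show "(if even (?k a) then sg (?k a div 2) * two_square_formula (?k a div 2) else 0) =
          (if M - a\<^sup>2 = 0 then 1 else 0) + 4 * (sg (?j a) * chi_sum (?j a))"
        by (simp only: *(1,2) if_True twisted_formula *(3))
    qed simp
    also have "\<dots> = (\<Sum>a\<in>?A. if M - a\<^sup>2 = 0 then 1 else 0) + 4 * ?K"
      by (simp only: sum.distrib sum_distrib_left[symmetric] sum_chi_sum_sols_1_8[OF M])
    also have "(\<Sum>a\<in>?A. if M - a\<^sup>2 = 0 then 1 else 0) = ?R"
    proof (rule sum.mono_neutral_left)
      have "odd M" using M by presburger
      thus "\<forall>a\<in>{-M..M} - ?A. (if M - a\<^sup>2 = 0 then 1 else 0) = (0::int)" by auto
    qed auto
    finally have E: "(\<Sum>(a, b, e)\<in>sols_1_4_4 M. sg b) = ?R + 4 * ?K" .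
    show ?thesis
    proof (cases "\<exists>s. M = s\<^sup>2")
      case False
      hence "?R = 0" by (intro sum.neutral) auto
      moreover have "?K = 0" using False sum_sols_1_8_nonsquare[OF M] by blast
      moreover have "(\<Sum>r\<in>{r. r\<^sup>2 = M \<and> 4 dvd r - 1}. r) = 0"
        by (rule sum.neutral) (use False in auto)
      ultimately show ?thesis using E by simp
    next
      case True
      then obtain s0 where s0: "M = s0\<^sup>2" by blast
      define s where "s = \<bar>s0\<bar>"
      have s: "M = s\<^sup>2" by (simp add: s_def s0)
      have "odd M" using M by presburger
      hence "odd s" by (simp add: s)
      moreover have "s \<ge> 0" by (simp add: s_def)
      ultimately have "s > 0" by (cases "s = 0") auto
      \<comment> \<open>The 2 from the roots \<open>s\<close> and \<open>- s\<close> cancels the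
        \<open>- 2\<close> in \<open>4 * ?K\<close>, leaving twice the root that is 1 modulo
        4.\<close>
      have "?R = 2" unfolding s using sum_roots_of_square[OF \<open>s > 0\<close>, of "\<lambda>_. 1"] by simp
      moreover have "4 * ?K = 2 * (chi s * s) - 2"
        unfolding s using sum_sols_1_8_square[OF \<open>s > 0\<close> \<open>odd s\<close>] by simp
      ultimately show ?thesis using E sum_roots_1_mod_4[OF \<open>odd s\<close>] by (simp add: s)
    qed
  qed
qed

subsection \<open>Signed sums over four squares and triangular numbers\<close>

text \<open>Modulo 8, \<open>p^2 + r^2\<close> is 2 and \<open>2 * m\<close> is 6. Hence for
  \<open>q = 2 * c\<close> and \<open>s = 2 * d\<close> exactly one of \<open>c\<close>,
  \<open>d\<close> is odd, and exchanging \<open>q\<close> and \<open>s\<close> flips the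
  sign.\<close>

lemma sum_sg_four_squares_3_mod_4:
  assumes "m mod 4 = 3"
  shows "(\<Sum>(p, q, r, s)\<in>four_squares m. sg (s div 2)) = 0"
proof (rule sum_antisymmetric_eq_0[where h = "\<lambda>(p, q, r, s). (p, s, r, q)"])
  fix v assume v: "v \<in> four_squares m"
  obtain p q r s where pqrs: "v = (p, q, r, s)" by (cases v)
  have *: "odd p" "even q" "odd r" "even s" "p\<^sup>2 + q\<^sup>2 + r\<^sup>2 + s\<^sup>2 = 2 * m"
    using v by (auto simp: four_squares_def pqrs)
  then obtain c d where cd: "q = 2 * c" "s = 2 * d" by (meson evenE)
  have "p\<^sup>2 + r\<^sup>2 + 4 * (c\<^sup>2 + d\<^sup>2) = 2 * m" using *(5) by (simp add: cd power_mult_distrib)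
  moreover have "odd k" if "x + y + 4 * k = 2 * m" "x mod 8 = 1" "y mod 8 = 1" for x y k
    using that assms by presburger
  ultimately have "odd (c\<^sup>2 + d\<^sup>2)"
    using odd_square_mod_8[OF *(1)] odd_square_mod_8[OF *(3)] by blast
  thus "(\<lambda>(p, q, r, s). sg (s div 2)) ((\<lambda>(p, q, r, s). (p, s, r, q)) v) =
      - (\<lambda>(p, q, r, s). sg (s div 2)) v"
    by (auto simp: pqrs cd sg_def)
qed (auto simp: four_squares_def)

definition sols_1_4_4_4 :: "int \<Rightarrow> (int \<times> int \<times> int \<times> int) set" where
  "sols_1_4_4_4 m = {(a, b, e, f). odd a \<and> m = a\<^sup>2 + 4 * (b\<^sup>2 + e\<^sup>2 + f\<^sup>2)}"

text \<open>Half sums and differences of \<open>(p, r)\<close> and \<open>(q, s)\<close> give the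
  new variables. Since \<open>a^2\<close> is 1 modulo 8, \<open>(m - 1) div 4\<close> has the parity
  of \<open>b + e + f\<close>, so the sign of \<open>s div 2 = e - f\<close> equals
  \<open>sg ((m - 1) div 4) * sg b\<close>.\<close>

lemma sum_sg_four_squares_half:
  assumes m: "m mod 4 = 1"
  shows "(\<Sum>(p, q, r, s)\<in>{(p, q, r, s) \<in> four_squares m. odd ((p + r) div 2)}. sg (s div 2)) =
    (\<Sum>(a, b, e, f)\<in>sols_1_4_4_4 m. sg ((m - 1) div 4) * sg b)"
proof (rule sum.reindex_bij_witness[where i = "\<lambda>(a, b, e, f). (a + 2 * b, 2 * (e + f), a - 2 * b, 2 * (e - f))"
      and j = "\<lambda>(p, q, r, s). ((p + r) div 2, (p - r) div 4, (q + s) div 4, (q - s) div 4)"])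
  let ?i = "\<lambda>(a, b, e, f). (a + 2 * b, 2 * (e + f), a - 2 * b, 2 * (e - f))"
  let ?j = "\<lambda>(p, q, r, s). ((p + r) div 2, (p - r) div 4, (q + s) div 4, (q - s) div 4)"
  fix v assume v: "v \<in> {(p, q, r, s) \<in> four_squares m. odd ((p + r) div 2)}"
  obtain p q r s where pqrs: "v = (p, q, r, s)" by (cases v)
  have *: "odd p" "even q" "odd r" "even s" "p\<^sup>2 + q\<^sup>2 + r\<^sup>2 + s\<^sup>2 = 2 * m" "odd ((p + r) div 2)"
    using v by (auto simp: four_squares_def pqrs)
  obtain c d where cd: "q = 2 * c" "s = 2 * d" using *(2,4) by (meson evenE)
  have "even (p + r)" using * by simp
  then obtain a where a: "p + r = 2 * a" by blast
  have "odd a" using *(6) by (simp add: a)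
  hence "even (p - a)" using * by simp
  then obtain b where b: "p - a = 2 * b" by blast
  have pr: "p = a + 2 * b" "r = a - 2 * b" using a b by auto
  \<comment> \<open>This equation modulo 4 makes \<open>c^2 + d^2\<close> even, which is what allows
    \<open>c\<close> and \<open>d\<close> to be replaced by \<open>e + f\<close> and
    \<open>e - f\<close>.\<close>
  have "m = a\<^sup>2 + 4 * b\<^sup>2 + 2 * (c\<^sup>2 + d\<^sup>2)"
    using *(5) by (simp add: cd pr power2_eq_square algebra_simps)
  moreover have "even k" if "m = x + 4 * y + 2 * k" "x mod 8 = 1" for x y k
    using that m by presburger
  ultimately have "even (c\<^sup>2 + d\<^sup>2)" using odd_square_mod_8[OF \<open>odd a\<close>] by blast
  hence "even (c + d)" by simp
  then obtain e where e: "c + d = 2 * e" by blast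
  define f where "f = c - e"
  have qs: "q = 2 * (e + f)" "s = 2 * (e - f)" using e by (auto simp: cd f_def)
  have m': "m = a\<^sup>2 + 4 * (b\<^sup>2 + e\<^sup>2 + f\<^sup>2)"
    using *(5) by (simp add: qs pr power2_eq_square algebra_simps)
  have j: "?j v = (a, b, e, f)"
    by (simp add: pqrs pr qs algebra_simps)
  show "?i (?j v) = v" unfolding j by (simp add: pqrs pr qs)
  show "?j v \<in> sols_1_4_4_4 m"
    unfolding j using m' \<open>odd a\<close> by (simp add: sols_1_4_4_4_def)
  have "even ((m - 1) div 4) \<longleftrightarrow> even k" if "m = x + 4 * k" "x mod 8 = 1" for x k
    using that by presburger
  from this[OF m' odd_square_mod_8[OF \<open>odd a\<close>]]
  have "even ((m - 1) div 4) \<longleftrightarrow> even (b\<^sup>2 + e\<^sup>2 + f\<^sup>2)" .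
  thus "(\<lambda>(a, b, e, f). sg ((m - 1) div 4) * sg b) (?j v) = (\<lambda>(p, q, r, s). sg (s div 2)) v"
    unfolding j by (auto simp: pqrs qs sg_def)
next
  let ?i = "\<lambda>(a, b, e, f). (a + 2 * b, 2 * (e + f), a - 2 * b, 2 * (e - f))"
  let ?j = "\<lambda>(p, q, r, s). ((p + r) div 2, (p - r) div 4, (q + s) div 4, (q - s) div 4)"
  fix v assume v: "v \<in> sols_1_4_4_4 m"
  obtain a b e f where abef: "v = (a, b, e, f)" by (cases v)
  have *: "odd a" "m = a\<^sup>2 + 4 * (b\<^sup>2 + e\<^sup>2 + f\<^sup>2)"
    using v by (auto simp: sols_1_4_4_4_def abef)
  show "?j (?i v) = v" by (simp add: abef algebra_simps)
  have "(a + 2 * b)\<^sup>2 + (2 * (e + f))\<^sup>2 + (a - 2 * b)\<^sup>2 + (2 * (e - f))\<^sup>2 = 2 * m"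
    unfolding *(2) by (simp add: power2_eq_square algebra_simps)
  moreover have "(a + 2 * b + (a - 2 * b)) div 2 = a" by simp
  ultimately show "?i v \<in> {(p, q, r, s) \<in> four_squares m. odd ((p + r) div 2)}"
    using *(1) by (simp add: abef four_squares_def)
qed

text \<open>For fixed \<open>f\<close> the number \<open>m - 4 * f^2\<close> is again 1 modulo 4, so
  the eta-cube identity evaluates the sum over \<open>(a, b, e)\<close>. The roots \<open>r\<close>
  of \<open>m - 4 * f^2\<close> together with \<open>f\<close> are the pairs on the right.\<close>

lemma sum_sg_sols_1_4_4_4:
  assumes m: "m mod 4 = 1"
  shows "(\<Sum>(a, b, e, f)\<in>sols_1_4_4_4 m. sg b) =
    2 * (\<Sum>(r, s)\<in>{(r, s). 4 dvd (r - 1) \<and> m = r\<^sup>2 + 4 * s\<^sup>2}. r)"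
proof -
  have bd: "-m \<le> f \<and> f \<le> m" if "m = x + 4 * f\<^sup>2" "x \<ge> 0" for f x
  proof (rule square_le_imp_abs_le)
    show "f\<^sup>2 \<le> m" using that zero_le_power2[of f] by linarith
  qed
  have mod: "(m - 4 * f\<^sup>2) mod 4 = 1" for f using m by presburger
  let ?R = "\<lambda>f. {r. r\<^sup>2 = m - 4 * f\<^sup>2 \<and> 4 dvd r - 1}"
  have fin: "finite (?R f)" for f
  proof (rule finite_subset)
    show "?R f \<subseteq> {-(m - 4 * f\<^sup>2)..m - 4 * f\<^sup>2}"
      using square_le_imp_abs_le[of _ "m - 4 * f\<^sup>2"] by auto
  qed simp
  have "(\<Sum>(a, b, e, f)\<in>sols_1_4_4_4 m. sg b) =
    (\<Sum>(f, v)\<in>(SIGMA f:{-m..m}. sols_1_4_4 (m - 4 * f\<^sup>2)). case v of (a, b, e) \<Rightarrow> sg b)"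
  proof (rule sum.reindex_bij_witness[where i = "\<lambda>(f, a, b, e). (a, b, e, f)"
        and j = "\<lambda>(a, b, e, f). (f, a, b, e)"])
    fix v assume v: "v \<in> sols_1_4_4_4 m"
    obtain a b e f where abef: "v = (a, b, e, f)" by (cases v)
    have *: "odd a" "m = a\<^sup>2 + 4 * (b\<^sup>2 + e\<^sup>2) + 4 * f\<^sup>2"
      using v by (auto simp: sols_1_4_4_4_def abef)
    have "-m \<le> f \<and> f \<le> m" by (rule bd[OF *(2)]) simp
    thus "(\<lambda>(a, b, e, f). (f, a, b, e)) v \<in> (SIGMA f:{-m..m}. sols_1_4_4 (m - 4 * f\<^sup>2))"
      using * by (simp add: abef sols_1_4_4_def)
  qed (auto simp: sols_1_4_4_4_def sols_1_4_4_def)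
  also have "\<dots> = (\<Sum>f\<in>{-m..m}. \<Sum>(a, b, e)\<in>sols_1_4_4 (m - 4 * f\<^sup>2). sg b)"
    by (rule sum.Sigma[symmetric]) (simp_all add: finite_sols_1_4_4 mod)
  also have "\<dots> = 2 * (\<Sum>f\<in>{-m..m}. \<Sum>r\<in>?R f. r)"
    unfolding sum_sols_1_4_4[OF mod] sum_distrib_left ..
  also have "(\<Sum>f\<in>{-m..m}. \<Sum>r\<in>?R f. r) = (\<Sum>(f, r)\<in>(SIGMA f:{-m..m}. ?R f). r)"
    by (rule sum.Sigma) (simp_all add: fin)
  also have "\<dots> = (\<Sum>(r, s)\<in>{(r, s). 4 dvd (r - 1) \<and> m = r\<^sup>2 + 4 * s\<^sup>2}. r)"
  proof (rule sum.reindex_bij_witness[where i = "\<lambda>(r, s). (s, r)" and j = "\<lambda>(s, r). (r, s)"])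
    fix v assume v: "v \<in> {(r, s). 4 dvd (r - 1) \<and> m = r\<^sup>2 + 4 * s\<^sup>2}"
    obtain r s where rs: "v = (r, s)" by (cases v)
    have *: "4 dvd r - 1" "m = r\<^sup>2 + 4 * s\<^sup>2" using v by (auto simp: rs)
    have "-m \<le> s \<and> s \<le> m" by (rule bd[OF *(2)]) simp
    with * show "(\<lambda>(r, s). (s, r)) v \<in> (SIGMA f:{-m..m}. ?R f)"
      by (simp add: rs)
  qed auto
  finally show ?thesis .
qed

text \<open>The numbers \<open>(p + r) div 2\<close> and \<open>(p - r) div 2\<close> differ by the
  odd number \<open>r\<close>. So \<open>r\<close> -> \<open>- r\<close> exchanges the solutions
  with even and odd \<open>(p + r) div 2\<close>, and the sum is twice its odd half.\<close>

lemma sum_sg_four_squares_1_mod_4: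
  assumes m: "m mod 4 = 1"
  shows "(\<Sum>(p, q, r, s)\<in>four_squares m. sg (s div 2)) =
    4 * sg ((m - 1) div 4) * (\<Sum>(r, s)\<in>{(r, s). 4 dvd (r - 1) \<and> m = r\<^sup>2 + 4 * s\<^sup>2}. r)"
proof -
  let ?h = "\<lambda>(p, q, r, s). sg (s div 2)"
  let ?O = "{(p, q, r, s) \<in> four_squares m. odd ((p + r) div 2)}"
  let ?E = "{(p, q, r, s) \<in> four_squares m. even ((p + r) div 2)}"
  have flip: "even ((p - r) div 2) \<longleftrightarrow> odd ((p + r) div 2)" if "odd p" "odd r" for p r :: int
    using that by presburger
  have "four_squares m = ?O \<union> ?E" by auto
  hence "sum ?h (four_squares m) = sum ?h (?O \<union> ?E)" by (rule arg_cong)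
  also have "\<dots> = sum ?h ?O + sum ?h ?E"
    by (rule sum.union_disjoint) (auto intro: finite_subset[OF _ finite_four_squares[of m]])
  also have "sum ?h ?E = sum ?h ?O"
    by (rule sum.reindex_bij_witness[where i = "\<lambda>(p, q, r, s). (p, q, - r, s)"
          and j = "\<lambda>(p, q, r, s). (p, q, - r, s)"]) (auto simp: four_squares_def flip)
  also have "sum ?h ?O = sg ((m - 1) div 4) * (\<Sum>(a, b, e, f)\<in>sols_1_4_4_4 m. sg b)"
    unfolding sum_sg_four_squares_half[OF m] by (simp add: sum_distrib_left split_def)
  finally show ?thesis unfolding sum_sg_sols_1_4_4_4[OF m] by simp
qed

section \<open>From triangular numbers to four squares\<close>

lemma eight_mult_triangular: "8 * (x * (x - 1) div 2) = (2 * x - 1)\<^sup>2 - 1" for x :: int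
proof -
  have "even (x * (x - 1))" by simp
  then obtain k where k: "x * (x - 1) = 2 * k" by blast
  have "(2 * x - 1)\<^sup>2 - 1 = 4 * (x * (x - 1))" by (simp add: power2_eq_square algebra_simps)
  thus ?thesis by (simp add: k)
qed

text \<open>For even \<open>x + y\<close>, \<open>p = x + y - 1\<close> and \<open>q = x - y\<close>
  are the half sum and half difference of \<open>2 * x - 1\<close> and \<open>2 * y - 1\<close>, and
  \<open>s = 2 * (2 * w - 1)\<close> runs through the residue class 2 modulo 4. The reflection
  \<open>y\<close> -> \<open>1 - y\<close> fixes the triangular number and changes the parity of
  \<open>x + y\<close>, hence the factor 2.\<close>

lemma t_eq_card_four_squares:
  "t 1 1 2 8 n = 2 * card {(p, q, r, s) \<in> four_squares (2 * int n + 3). s mod 4 = 2}"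
proof -
  let ?Q = "{(p, q, r, s) \<in> four_squares (2 * int n + 3). s mod 4 = 2}"
  define T where "T = {(x, y, z, w). (2 * x - 1)\<^sup>2 + (2 * y - 1)\<^sup>2 + 2 * (2 * z - 1)\<^sup>2 + 8 * (2 * w - 1)\<^sup>2 = 8 * int n + 12}"
  define E where "E = {(x, y, z, w) \<in> T. even (x + y)}"
  define F where "F = {(x, y, z, w) \<in> T. odd (x + y)}"
  let ?i = "\<lambda>(x, y, z, w). (x + y - 1, x - y, 2 * z - 1, 4 * w - 2)"
  let ?j = "\<lambda>(p, q, r, s). ((p + q + 1) div 2, (p - q + 1) div 2, (r + 1) div 2, (s + 2) div 4)"
  have EQ: "bij_betw ?i E ?Q"
  proof (rule bij_betw_byWitness[where f' = ?j])
    show "\<forall>v\<in>E. ?j (?i v) = v" by auto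
    have inv: "?i (?j v) = v" if "v \<in> ?Q" for v
    proof -
      obtain p q r s where pqrs: "v = (p, q, r, s)" by (cases v)
      have *: "odd p" "even q" "odd r" "s mod 4 = 2"
        using that by (auto simp: four_squares_def pqrs)
      hence "(p + q + 1) div 2 + (p - q + 1) div 2 - 1 = p" "(p + q + 1) div 2 - (p - q + 1) div 2 = q"
        "2 * ((r + 1) div 2) - 1 = r" "4 * ((s + 2) div 4) - 2 = s"
        by presburger+
      thus ?thesis by (simp add: pqrs)
    qed
    thus "\<forall>v\<in>?Q. ?i (?j v) = v" by blast
    have mem: "?i v \<in> ?Q \<longleftrightarrow> v \<in> E" for v
    proof -
      obtain x y z w where v: "v = (x, y, z, w)" by (cases v)
      have "(x + y - 1)\<^sup>2 + (x - y)\<^sup>2 + (2 * z - 1)\<^sup>2 + (4 * w - 2)\<^sup>2 = 2 * (2 * int n + 3) \<longleftrightarrow>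
          (2 * x - 1)\<^sup>2 + (2 * y - 1)\<^sup>2 + 2 * (2 * z - 1)\<^sup>2 + 8 * (2 * w - 1)\<^sup>2 = 8 * int n + 12"
        by (auto simp: power2_eq_square algebra_simps)
      moreover have "(4 * w - 2) mod 4 = 2" by presburger
      ultimately show ?thesis by (auto simp: v four_squares_def E_def T_def)
    qed
    show "?i ` E \<subseteq> ?Q" by (rule image_subsetI) (rule mem[THEN iffD2])
    show "?j ` ?Q \<subseteq> E"
    proof (rule image_subsetI)
      fix v assume v: "v \<in> ?Q"
      show "?j v \<in> E" by (rule mem[THEN iffD1]) (subst inv[OF v], rule v)
    qed
  qed
  have FE: "bij_betw (\<lambda>(x, y, z, w). (x, 1 - y, z, w)) F E"
    by (rule bij_betw_byWitness[where f' = "\<lambda>(x, y, z, w). (x, 1 - y, z, w)"])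
      (auto simp: E_def F_def T_def power2_eq_square algebra_simps)
  have "finite ?Q" by (rule finite_subset[OF _ finite_four_squares[of "2 * int n + 3"]]) auto
  hence finE: "finite E" using bij_betw_finite[OF EQ] by simp
  hence finF: "finite F" using bij_betw_finite[OF FE] by simp
  \<comment> \<open>The constant 12 is \<open>1 + 1 + 2 + 8\<close>, left over from completing the
    squares.\<close>
  have "k = X + Y + 2 * Z + 8 * W \<longleftrightarrow> A + B + 2 * C + 8 * D = 8 * k + 12"
    if "8 * X = A - 1" "8 * Y = B - 1" "8 * Z = C - 1" "8 * W = D - 1" for A B C D X Y Z W k :: int
    using that by (intro iffI; linarith)
  note scale = this[OF eight_mult_triangular eight_mult_triangular eight_mult_triangular eight_mult_triangular]
  have "t 1 1 2 8 n = card T"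
    unfolding t_def T_def of_nat_1 of_nat_numeral mult_1 scale ..
  also have "T = E \<union> F" by (auto simp: E_def F_def)
  also have "card (E \<union> F) = card E + card F"
    by (rule card_Un_disjoint) (use finE finF in \<open>auto simp: E_def F_def\<close>)
  also have "card E + card F = 2 * card ?Q"
    using bij_betw_same_card[OF EQ] bij_betw_same_card[OF FE] by simp
  finally show ?thesis .
qed

theorem theorem3p1:
  fixes n :: nat
  assumes "n > 0"
  shows "int (t 1 1 2 8 n) =
    (if even n then 4 * int (sigma (2 * n + 3))
     else 4 * int (sigma (2 * n + 3)) + 4 * (-1) ^ ((n - 1) div 2) *
       (\<Sum>(r, s) \<in> {(r::int, s::int). 4 dvd (r - 1) \<and> int (2 * n + 3) = r\<^sup>2 + 4 * s\<^sup>2}. r))"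
proof -
  define m where "m = 2 * int n + 3"
  let ?f = "\<lambda>(p, q, r, s). if s mod 4 = 2 then 1 else (0::int)"
  have "int (card {(p, q, r, s) \<in> four_squares m. s mod 4 = 2}) = sum ?f (four_squares m)"
  proof -
    have "sum ?f (four_squares m) = sum (\<lambda>_. 1) {(p, q, r, s) \<in> four_squares m. s mod 4 = 2}"
      by (rule sum.mono_neutral_cong_right) (auto simp: finite_four_squares split: if_splits)
    thus ?thesis by simp
  qed
  hence "int (t 1 1 2 8 n) = (\<Sum>v\<in>four_squares m. 2 * ?f v)"
    unfolding t_eq_card_four_squares m_def[symmetric] by (simp add: sum_distrib_left)
  \<comment> \<open>For even \<open>s\<close> the indicator of \<open>s mod 4 = 2\<close> is half of
    \<open>1 - (-1)^(s/2)\<close>; this separates the plain count from the signed sum.\<close>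
  also have "\<dots> = (\<Sum>v\<in>four_squares m. 1 - (case v of (p, q, r, s) \<Rightarrow> sg (s div 2)))"
  proof (rule sum.cong)
    fix v assume v: "v \<in> four_squares m"
    obtain p q r s where pqrs: "v = (p, q, r, s)" by (cases v)
    have "even s" using v by (simp add: pqrs four_squares_def)
    hence "s mod 4 = 2 \<longleftrightarrow> odd (s div 2)" by presburger
    thus "2 * ?f v = 1 - (case v of (p, q, r, s) \<Rightarrow> sg (s div 2))"
      by (simp add: pqrs sg_def)
  qed simp
  also have "\<dots> = 4 * int (sigma (nat m)) - (\<Sum>(p, q, r, s)\<in>four_squares m. sg (s div 2))"
    using card_four_squares[of m] by (simp add: sum_subtractf m_def)
  also have "nat m = 2 * n + 3" by (simp add: m_def)
  finally have t: "int (t 1 1 2 8 n) =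
    4 * int (sigma (2 * n + 3)) - (\<Sum>(p, q, r, s)\<in>four_squares m. sg (s div 2))" .
  show ?thesis
  proof (cases "even n")
    case True
    have "m mod 4 = 3" using True unfolding m_def by presburger
    thus ?thesis using True t by (simp add: sum_sg_four_squares_3_mod_4)
  next
    case False
    then obtain k where k: "n = 2 * k + 1" by (rule oddE)
    have m: "m mod 4 = 1" "(m - 1) div 4 = int k + 1" "int (2 * n + 3) = m"
      unfolding m_def k by simp_all
    \<comment> \<open>The exponent \<open>(m - 1) div 4\<close> exceeds \<open>(n - 1) div 2\<close>
      by one, so the minus sign in front of the signed sum disappears.\<close>
    have "sg (int k + 1) = - ((-1) ^ ((n - 1) div 2))" by (auto simp: k sg_def)
    thus ?thesis using False t unfolding sum_sg_four_squares_1_mod_4[OF m(1)] m(2,3) by simp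
  qed
qed

end
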